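(* Let $K$ be a field, $S=K[x_1,\ldots,x_n]$, and let $d\ge 1$, $r\ge 1$ be integers. Let $J\subsetneq I$ be squarefree monomial ideals of $S$ such that the minimal set of monomial generators of $I$ consists of squarefree monomials $f_1,\ldots,f_r$ of degree $d$ together with a (possibly empty) set $E$ of squarefree monomials of degree $\ge d+1$, and such that $J$ is zero or generated by monomials of degree $\ge d+1$. Let $B$ (resp. $C$) be the set of squarefree monomials of degree $d+1$ (resp. $d+2$) in $I\setminus J$, and let $W=\{w_{ij}: 1\le i<j\le r\}$, where $w_{ij}=\operatorname{lcm}(f_i,f_j)$. If $B\cap (f_1,\ldots,f_r)\subset W$ and $C\cap W=\emptyset$, then $\operatorname{depth}_S I/J\le \operatorname{sdepth}_S I/J$, that is, Stanley's Conjecture holds for $I/J$.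
   Context: $(f_1,\ldots,f_r)$ denotes the ideal of $S$ generated by $f_1,\ldots,f_r$. Depth of a finitely generated graded $S$-module is taken with respect to the maximal ideal $(x_1,\ldots,x_n)$. Stanley depth: let $P_{I\setminus J}$ be the poset of all squarefree monomials of $I\setminus J$ ordered by divisibility. For $u,v\in P_{I\setminus J}$ with $u\mid v$, the interval is $[u,v]=\{w\in P_{I\setminus J}: u\mid w,\ w\mid v\}$. For a partition $P$ of $P_{I\setminus J}$ into disjoint intervals, $P_{I\setminus J}=\bigcup_i[u_i,v_i]$, put $\operatorname{sdepth}P=\min_i\deg v_i$. The Stanley depth is $\operatorname{sdepth}_S I/J=\max_P\operatorname{sdepth}P$, the maximum over all such partitions $P$. Stanley's Conjecture for $I/J$ is the inequality $\operatorname{sdepth}_S I/J\ge\operatorname{depth}_S I/J$. *)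

theory Defs
  imports Complex_Main "HOL-Library.Disjoint_Sets" "HOL-Library.Poly_Mapping" "HOL-Library.Extended_Nat"
begin

text \<open>
  The finite index type \<open>'n\<close> names the variables, so \<open>n\<close> is the cardinality of \<open>'n\<close> and
  the polynomial ring \<open>S\<close> is \<^typ>\<open>('n \<Rightarrow>\<^sub>0 nat) \<Rightarrow>\<^sub>0 'k\<close>. Monomials are represented by their
  exponent vectors. The library order on \<^typ>\<open>'n \<Rightarrow>\<^sub>0 nat\<close> is lexicographic, hence the
  separate divisibility relation below.
\<close>

type_synonym 'n monomial = "'n \<Rightarrow>\<^sub>0 nat"
type_synonym ('n, 'k) mpoly = "'n monomial \<Rightarrow>\<^sub>0 'k"

definition mon :: "'n monomial \<Rightarrow> ('n, 'k::zero_neq_one) mpoly" where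
  "mon u = Poly_Mapping.single u 1"

definition mdeg :: "'n::finite monomial \<Rightarrow> nat" where
  "mdeg u = (\<Sum>i\<in>UNIV. Poly_Mapping.lookup u i)"

definition squarefree_mon :: "'n monomial \<Rightarrow> bool" where
  "squarefree_mon u \<longleftrightarrow> (\<forall>i. Poly_Mapping.lookup u i \<le> 1)"

definition mdvd :: "'n monomial \<Rightarrow> 'n monomial \<Rightarrow> bool" where
  "mdvd u v \<longleftrightarrow> (\<exists>w. v = u + w)"

lift_definition mlcm :: "'n monomial \<Rightarrow> 'n monomial \<Rightarrow> 'n monomial"
  is "\<lambda>u v i. max (u i) (v i)"
proof -
  fix u v :: "'n \<Rightarrow> nat"
  assume "finite {i. u i \<noteq> 0}" and "finite {i. v i \<noteq> 0}"
  then have "finite ({i. u i \<noteq> 0} \<union> {i. v i \<noteq> 0})"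
    by simp
  then show "finite {i. max (u i) (v i) \<noteq> 0}"
    by (rule rev_finite_subset) auto
qed


text \<open>Ideals of a commutative ring are the submodules of the ring over itself.\<close>

lemma module_ring_mult: "module ((*) :: 'a::comm_ring_1 \<Rightarrow> 'a \<Rightarrow> 'a)"
  by unfold_locales (simp_all add: algebra_simps)

abbreviation ideal_gen :: "'a::comm_ring_1 set \<Rightarrow> 'a set" where
  "ideal_gen \<equiv> module.span (*)"

definition squarefree_monomial_ideal :: "('n, 'k::field) mpoly set \<Rightarrow> bool" where
  "squarefree_monomial_ideal I \<longleftrightarrow> (\<exists>G. (\<forall>u\<in>G. squarefree_mon u) \<and> I = ideal_gen (mon ` G))"

definition minimal_monomial_generators :: "'n monomial set \<Rightarrow> ('n, 'k::field) mpoly set \<Rightarrow> bool" where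
  "minimal_monomial_generators G I \<longleftrightarrow>
     I = ideal_gen (mon ` G) \<and> (\<forall>G'. G' \<subset> G \<longrightarrow> ideal_gen (mon ` G') \<noteq> I)"

definition max_ideal :: "('n, 'k::field) mpoly set" where
  "max_ideal = ideal_gen (range (\<lambda>i. mon (Poly_Mapping.single i 1)))"


text \<open>
  For \<open>M = I/J\<close> we have \<open>M/(g\<^sub>1,\<dots>,g\<^sub>k)M = I / (J + (g\<^sub>1,\<dots>,g\<^sub>k)I)\<close>. The denominator is
  \<open>quot_denom I J [g\<^sub>1,\<dots>,g\<^sub>k]\<close>. The sequence is regular on \<open>I/J\<close> if each \<open>g\<^sub>i\<close> is a
  nonzerodivisor on \<open>M/(g\<^sub>1,\<dots>,g\<^sub>i\<^sub>-\<^sub>1)M\<close> and \<open>M \<noteq> (g\<^sub>1,\<dots>,g\<^sub>k)M\<close>. (List indices start at 0.)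
\<close>

definition quot_denom :: "'a::comm_ring_1 set \<Rightarrow> 'a set \<Rightarrow> 'a list \<Rightarrow> 'a set" where
  "quot_denom I J gs = ideal_gen (J \<union> {g * a | g a. g \<in> set gs \<and> a \<in> I})"

definition regular_seq :: "'a::comm_ring_1 set \<Rightarrow> 'a set \<Rightarrow> 'a list \<Rightarrow> bool" where
  "regular_seq I J gs \<longleftrightarrow>
     (\<forall>i<length gs. \<forall>a\<in>I. gs ! i * a \<in> quot_denom I J (take i gs) \<longrightarrow>
                              a \<in> quot_denom I J (take i gs)) \<and>
     quot_denom I J gs \<noteq> I"

text \<open>Depth is only meaningful for \<open>J \<subset> I\<close>, i.e. for a nonzero module.\<close>

definition depth :: "('n, 'k::field) mpoly set \<Rightarrow> ('n, 'k) mpoly set \<Rightarrow> enat" where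
  "depth I J = Sup {enat (length gs) | gs. set gs \<subseteq> max_ideal \<and> regular_seq I J gs}"


definition sqfree_poset ::
    "('n, 'k::field) mpoly set \<Rightarrow> ('n, 'k) mpoly set \<Rightarrow> 'n monomial set" where
  "sqfree_poset I J = {u. squarefree_mon u \<and> mon u \<in> I - J}"

definition sqfree_mons_of_deg ::
    "('n::finite, 'k::field) mpoly set \<Rightarrow> ('n, 'k) mpoly set \<Rightarrow> nat \<Rightarrow> 'n monomial set" where
  "sqfree_mons_of_deg I J k = {u \<in> sqfree_poset I J. mdeg u = k}"

definition interval :: "'n monomial set \<Rightarrow> 'n monomial \<times> 'n monomial \<Rightarrow> 'n monomial set" where
  "interval P p = {w \<in> P. mdvd (fst p) w \<and> mdvd w (snd p)}"

text \<open>
  A partition into intervals is the set of its endpoint pairs. The intervals are nonempty, so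
  disjoint intervals have distinct pairs of endpoints.
\<close>

definition interval_partition ::
    "'n monomial set \<Rightarrow> ('n monomial \<times> 'n monomial) set \<Rightarrow> bool" where
  "interval_partition P Q \<longleftrightarrow>
     Q \<subseteq> P \<times> P \<and> (\<forall>(u, v)\<in>Q. mdvd u v) \<and>
     disjoint_family_on (interval P) Q \<and> (\<Union>p\<in>Q. interval P p) = P"

text \<open>
  For \<open>J \<subset> I\<close> squarefree monomial ideals the poset is finite and nonempty, so both \<open>Max\<close> and
  \<open>Min\<close> range over finite nonempty sets.
\<close>

definition sdepth_partition :: "('n::finite monomial \<times> 'n monomial) set \<Rightarrow> nat" where
  "sdepth_partition Q = Min ((\<lambda>(u, v). mdeg v) ` Q)"

definition sdepth :: "('n::finite, 'k::field) mpoly set \<Rightarrow> ('n, 'k) mpoly set \<Rightarrow> nat" where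
  "sdepth I J = Max (sdepth_partition ` {Q. interval_partition (sqfree_poset I J) Q})"

end

theory Submission
  imports Defs
begin

text \<open>
  Squarefree monomials are identified with their supports, so \<open>I\<close> and \<open>J\<close> become up-closed
  families of sets, and \<open>I \<setminus> J\<close> a convex family \<open>P\<close> whose \<open>d\<close>-sets are the \<open>f\<^sub>i\<close>.

  A cocycle on the \<open>k\<close>-sets of \<open>P\<close> that contain a fixed set \<open>\<tau>\<close>, if it is not a coboundary, gives a
  nonzero class in the Koszul cohomology of \<open>I/J\<close> on the squares of the variables, and this bounds
  the depth by \<open>k\<close>. Such classes give two bounds.

  \<^item> If no system of distinct \<open>b \<in> B\<close> with \<open>f\<^sub>i | b\<close> exists, then the coboundary map from the
    \<open>d\<close>-sets to the \<open>(d+1)\<close>-sets has a kernel, so the depth is at most \<open>d\<close>, which never exceeds the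
    Stanley depth. Otherwise the intervals \<open>[f\<^sub>i, b]\<close> together with singletons show that the Stanley
    depth is at least \<open>d + 1\<close>.

  \<^item> The depth is at most \<open>d + 1\<close>. A maximal \<open>b \<in> B \<inter> (f\<^sub>1, \<dots>, f\<^sub>r)\<close> is a class with \<open>\<tau> = b\<close>.
    Otherwise \<open>b\<close> is a multiple of exactly two \<open>f\<^sub>i\<close>. Call \<open>v\<close> a core vertex of \<open>F = f\<^sub>i\<close> if
    every \<open>F \<union> {a}\<close> in \<open>P\<close> contains the generator \<open>F - {v} \<union> {a}\<close>. If some \<open>F\<close> has no core
    vertex, the condition on \<open>C\<close> makes the link of \<open>F\<close> disconnected, which is a class with
    \<open>\<tau> = F\<close>. If all have one, the generators \<open>G \<union> {v}\<close> with a common \<open>G\<close> and core vertex \<open>v\<close>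
    carry a \<open>d\<close>-cocycle.
\<close>

section \<open>Systems of distinct representatives from independent rows\<close>

text \<open>The analogue of expanding a nonzero determinant along row \<open>i\<close>: some column
  \<open>b\<close> with \<open>v i b \<noteq> 0\<close> can be deleted while the rows in
  \<open>X\<close> stay independent, and induction matches them off \<open>b\<close>.\<close>

lemma independent_rows_matching:
  fixes v :: "'a \<Rightarrow> 'b \<Rightarrow> 'k::field"
  assumes "finite X" "finite Y"
    and "\<And>c. (\<And>b. b \<in> Y \<Longrightarrow> (\<Sum>i\<in>X. c i * v i b) = 0) \<Longrightarrow> \<forall>i\<in>X. c i = 0"
  shows "\<exists>\<phi>. inj_on \<phi> X \<and> (\<forall>i\<in>X. \<phi> i \<in> Y \<and> v i (\<phi> i) \<noteq> 0)"
  using assms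
proof (induction X arbitrary: Y rule: finite_induct)
  case (insert i X)
  have indep: "\<forall>j\<in>X. c j = 0"
    if "\<And>b. b \<in> Y \<Longrightarrow> (\<Sum>j\<in>X. c j * v j b) = 0" for c
  proof -
    have "(\<Sum>j\<in>insert i X. (if j = i then 0 else c j) * v j b) = 0" if "b \<in> Y" for b
    proof -
      have "(\<Sum>j\<in>X. (if j = i then 0 else c j) * v j b) = (\<Sum>j\<in>X. c j * v j b)"
        using insert.hyps(2) by (intro sum.cong) auto
      then show ?thesis
        using \<open>b \<in> Y \<Longrightarrow> (\<Sum>j\<in>X. c j * v j b) = 0\<close>[OF that] insert.hyps by simp
    qed
    then have zero: "\<forall>j\<in>insert i X. (if j = i then 0 else c j) = 0"
      by (rule insert.prems(2))
    show ?thesis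
    proof
      fix j assume "j \<in> X"
      then show "c j = 0"
        using bspec[OF zero, of j] insert.hyps(2) by (cases "j = i") simp_all
    qed
  qed
  have "\<exists>b\<in>Y. v i b \<noteq> 0 \<and>
      (\<forall>c. (\<forall>b'\<in>Y - {b}. (\<Sum>j\<in>X. c j * v j b') = 0) \<longrightarrow> (\<forall>j\<in>X. c j = 0))"
  proof (rule ccontr)
    assume none: "\<not> ?thesis"
    define Y' where "Y' = {b \<in> Y. v i b \<noteq> 0}"
    \<comment> \<open>Deleting column \<open>b\<close> creates a relation \<open>c\<close> between
      the rows in \<open>X\<close>. It is no relation on all of \<open>Y\<close>, so its value
      \<open>s\<close> at \<open>b\<close> is nonzero, and \<open>c / s\<close> combines the rows
      into the unit vector at \<open>b\<close>.\<close>
    have "\<exists>u. \<forall>b'\<in>Y. (\<Sum>j\<in>X. u j * v j b') = (if b' = b then 1 else 0)" if b: "b \<in> Y'" for b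
    proof -
      obtain c where c: "\<And>b'. b' \<in> Y - {b} \<Longrightarrow> (\<Sum>j\<in>X. c j * v j b') = 0" "\<not> (\<forall>j\<in>X. c j = 0)"
      proof -
        have "b \<in> Y" "v i b \<noteq> 0"
          using b by (simp_all add: Y'_def)
        then have "\<not> (\<forall>c. (\<forall>b'\<in>Y - {b}. (\<Sum>j\<in>X. c j * v j b') = 0) \<longrightarrow> (\<forall>j\<in>X. c j = 0))"
          using none by blast
        then show thesis
          using that by (simp only: not_all not_imp) blast
      qed
      define s where "s = (\<Sum>j\<in>X. c j * v j b)"
      have "s \<noteq> 0"
      proof
        assume "s = 0"
        then have "(\<Sum>j\<in>X. c j * v j b') = 0" if "b' \<in> Y" for b'
          using c(1)[of b'] that by (cases "b' = b") (simp_all add: s_def)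
        with indep[of c] c(2) show False
          by blast
      qed
      have "(\<Sum>j\<in>X. c j / s * v j b') = (if b' = b then 1 else 0)" if "b' \<in> Y" for b'
      proof -
        have "(\<Sum>j\<in>X. c j / s * v j b') = (\<Sum>j\<in>X. c j * v j b') / s"
          unfolding sum_divide_distrib by (rule sum.cong) simp_all
        then show ?thesis
          using c(1)[of b'] that \<open>s \<noteq> 0\<close> by (cases "b' = b") (simp_all add: s_def)
      qed
      then show ?thesis
        by (intro exI[of _ "\<lambda>j. c j / s"] ballI)
    qed
    then have "\<forall>b\<in>Y'. \<exists>u. \<forall>b'\<in>Y. (\<Sum>j\<in>X. u j * v j b') = (if b' = b then 1 else 0)"
      by (rule ballI)
    from bchoice[OF this] obtain u where u: "\<And>b b'. b \<in> Y' \<Longrightarrow> b' \<in> Y \<Longrightarrow>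
        (\<Sum>j\<in>X. u b j * v j b') = (if b' = b then 1 else 0)"
      by blast
    \<comment> \<open>Row \<open>i\<close> is supported on \<open>Y'\<close>, hence a combination of
      these unit vectors; \<open>c\<close> is the resulting relation, with coefficient 1 at
      \<open>i\<close>.\<close>
    define c where "c j = (if j = i then 1 else - (\<Sum>b\<in>Y'. v i b * u b j))" for j
    have "(\<Sum>j\<in>insert i X. c j * v j b') = 0" if b': "b' \<in> Y" for b'
    proof -
      have "(\<Sum>j\<in>X. c j * v j b') = (\<Sum>j\<in>X. \<Sum>b\<in>Y'. - (v i b * (u b j * v j b')))"
      proof (rule sum.cong[OF refl])
        fix j assume "j \<in> X"
        then have "c j = - (\<Sum>b\<in>Y'. v i b * u b j)"
          using insert.hyps(2) by (auto simp: c_def)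
        then show "c j * v j b' = (\<Sum>b\<in>Y'. - (v i b * (u b j * v j b')))"
          by (simp add: sum_distrib_right sum_negf mult.assoc)
      qed
      also have "\<dots> = (\<Sum>b\<in>Y'. - (v i b * (\<Sum>j\<in>X. u b j * v j b')))"
        by (subst sum.swap) (simp add: sum_negf sum_distrib_left)
      also have "\<dots> = (\<Sum>b\<in>Y'. if b' = b then - v i b else 0)"
        using u b' by (intro sum.cong) auto
      also have "\<dots> = - v i b'"
        using insert.prems(1) b' by (simp add: Y'_def)
      finally show ?thesis
        using insert.hyps by (simp add: c_def)
    qed
    then have "\<forall>j\<in>insert i X. c j = 0"
      by (rule insert.prems(2))
    then show False
      by (simp add: c_def)
  qed
  then obtain b where b: "b \<in> Y" "v i b \<noteq> 0"
    and "\<forall>c. (\<forall>b'\<in>Y - {b}. (\<Sum>j\<in>X. c j * v j b') = 0) \<longrightarrow> (\<forall>j\<in>X. c j = 0)"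
    by blast
  then obtain \<phi> where \<phi>: "inj_on \<phi> X" "\<forall>j\<in>X. \<phi> j \<in> Y - {b} \<and> v j (\<phi> j) \<noteq> 0"
    using insert.IH[of "Y - {b}"] insert.prems(1) by blast
  have "inj_on (\<phi>(i := b)) (insert i X)"
    using \<phi> insert.hyps(2) by (auto simp: inj_on_def)
  moreover have "\<forall>j\<in>insert i X. (\<phi>(i := b)) j \<in> Y \<and> v j ((\<phi>(i := b)) j) \<noteq> 0"
    using \<phi>(2) b by auto
  ultimately show ?case
    by blast
qed simp

section \<open>The Koszul complex\<close>

text \<open>An arbitrary linear order on the variables, used for the signs.\<close>

definition var_index :: "'i::finite \<Rightarrow> nat" where
  "var_index = (SOME f. inj f)"

lemma inj_var_index: "inj (var_index :: 'i::finite \<Rightarrow> nat)"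
proof -
  obtain f :: "'i \<Rightarrow> nat" where "inj f"
    using finite_imp_inj_to_nat_seg[OF finite[of "UNIV :: 'i set"]] by blast
  then show ?thesis
    unfolding var_index_def by (rule someI[where P = inj])
qed

definition ksign :: "'i::finite \<Rightarrow> 'i set \<Rightarrow> 'a::comm_ring_1" where
  "ksign j \<sigma> = (- 1) ^ card {i \<in> \<sigma>. var_index i < var_index j}"

lemma ksign_square: "ksign j \<sigma> * ksign j \<sigma> = 1"
  by (simp add: ksign_def minus_one_power_iff)

lemma ksign_square_left: "ksign j \<sigma> * (ksign j \<sigma> * a) = a"
  by (simp add: ksign_square mult.assoc[symmetric])

lemma ksign_nonzero: "ksign j \<sigma> \<noteq> (0 :: 'a::comm_ring_1)"
  using ksign_square[of j \<sigma>, where ?'a = 'a] by auto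

text \<open>Deleting the earlier of two elements shifts the position of the later one by one;
  deleting the later one leaves the earlier one in place.\<close>

lemma ksign_swap:
  assumes "finite \<sigma>" "j \<in> \<sigma>" "k \<in> \<sigma>" "j \<noteq> k"
  shows "ksign j \<sigma> * ksign k (\<sigma> - {j}) = - (ksign k \<sigma> * ksign j (\<sigma> - {k}) :: 'a::comm_ring_1)"
proof -
  have *: "ksign k \<sigma> = - (ksign k (\<sigma> - {j}) :: 'a)" "ksign j (\<sigma> - {k}) = (ksign j \<sigma> :: 'a)"
    if "j \<in> \<sigma>" "k \<in> \<sigma>" "var_index j < var_index k" for j k
  proof -
    have "{i \<in> \<sigma>. var_index i < var_index k} = insert j {i \<in> \<sigma> - {j}. var_index i < var_index k}"
      using that by auto
    then show "ksign k \<sigma> = - (ksign k (\<sigma> - {j}) :: 'a)"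
      using \<open>finite \<sigma>\<close> by (simp add: ksign_def)
    have "{i \<in> \<sigma> - {k}. var_index i < var_index j} = {i \<in> \<sigma>. var_index i < var_index j}"
      using that by auto
    then show "ksign j (\<sigma> - {k}) = (ksign j \<sigma> :: 'a)"
      by (simp add: ksign_def)
  qed
  have "var_index j < var_index k \<or> var_index k < var_index j"
    using \<open>j \<noteq> k\<close> by (metis injD inj_var_index linorder_neqE_nat)
  then show ?thesis
  proof
    assume "var_index j < var_index k"
    note * = *[OF assms(2,3) this]
    show ?thesis
      unfolding *(2) unfolding *(1) by (simp add: mult.commute)
  next
    assume "var_index k < var_index j"
    note * = *[OF assms(3,2) this]
    show ?thesis
      unfolding *(2) unfolding *(1) by (simp add: mult.commute)
  qed
qed

text \<open>The Koszul differential: exterior multiplication by the sum of the \<open>y j\<close>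
  times basis vectors, with \<open>c \<sigma>\<close> the coefficient at the wedge of
  \<open>\<sigma>\<close>. Cochains are functions on all sets, so every degree is treated at
  once.\<close>

definition koszul :: "('i::finite \<Rightarrow> 'a::comm_ring_1) \<Rightarrow> ('i set \<Rightarrow> 'a) \<Rightarrow> 'i set \<Rightarrow> 'a" where
  "koszul y c \<sigma> = (\<Sum>j\<in>\<sigma>. ksign j \<sigma> * y j * c (\<sigma> - {j}))"

lemma koszul_add: "koszul y (\<lambda>\<rho>. c \<rho> + c' \<rho>) \<sigma> = koszul y c \<sigma> + koszul y c' \<sigma>"
  by (simp add: koszul_def distrib_left sum.distrib)

lemma koszul_mult: "koszul y (\<lambda>\<rho>. a * c \<rho>) \<sigma> = a * koszul y c \<sigma>"
  by (simp add: koszul_def sum_distrib_left mult.left_commute[of a])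

text \<open>Deleting \<open>j\<close> then \<open>k\<close> and deleting \<open>k\<close> then
  \<open>j\<close> contribute terms that cancel by \<open>ksign_swap\<close>.\<close>

lemma koszul_koszul:
  fixes y :: "'i::finite \<Rightarrow> 'a::comm_ring_1"
  shows "koszul y (koszul y c) \<sigma> = 0"
proof -
  let ?t = "\<lambda>(j, k). ksign j \<sigma> * ksign k (\<sigma> - {j}) * (y j * y k * c (\<sigma> - {j} - {k}))"
  let ?A = "{(j, k). j \<in> \<sigma> \<and> k \<in> \<sigma> \<and> var_index j < var_index k}"
  let ?B = "{(j, k). j \<in> \<sigma> \<and> k \<in> \<sigma> \<and> var_index k < var_index j}"
  have "koszul y (koszul y c) \<sigma> = (\<Sum>j\<in>\<sigma>. \<Sum>k\<in>\<sigma> - {j}. ?t (j, k))"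
    unfolding koszul_def sum_distrib_left prod.case
    by (intro sum.cong refl) (simp only: ac_simps)
  also have "\<dots> = sum ?t (SIGMA j:\<sigma>. \<sigma> - {j})"
    by (subst sum.Sigma) auto
  also have "(SIGMA j:\<sigma>. \<sigma> - {j}) = ?A \<union> ?B"
  proof -
    have "k \<noteq> j \<longleftrightarrow> var_index j < var_index k \<or> var_index k < var_index j" for j k :: 'i
      by (metis inj_eq inj_var_index nat_neq_iff)
    then show ?thesis
      by blast
  qed
  also have "sum ?t (?A \<union> ?B) = sum ?t ?A + sum ?t ?B"
    by (rule sum.union_disjoint) auto
  also have "sum ?t ?B = sum (\<lambda>p. - ?t p) ?A"
  proof (rule sum.reindex_bij_witness[of _ prod.swap prod.swap])
    fix p assume "p \<in> ?B"
    then obtain j k where p: "p = (j, k)" and jk: "j \<in> \<sigma>" "k \<in> \<sigma>" "j \<noteq> k"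
      by auto
    have "\<sigma> - {k} - {j} = \<sigma> - {j} - {k}"
      by auto
    then have "?t p = ksign j \<sigma> * ksign k (\<sigma> - {j}) * (y j * y k * c (\<sigma> - {k} - {j}))"
      unfolding p by simp
    also have "\<dots> = - ?t (prod.swap p)"
      unfolding p ksign_swap[OF finite jk] by (simp add: mult.commute[of "y j"])
    finally show "- ?t (prod.swap p) = ?t p"
      by simp
  qed auto
  finally show ?thesis
    by (simp add: sum_negf)
qed

text \<open>Contraction with the basis vector of \<open>j\<close> is a homotopy from multiplication
  by \<open>y j\<close> to zero, so \<open>y j\<close> annihilates the cohomology.\<close>

lemma koszul_homotopy:
  fixes y :: "'i::finite \<Rightarrow> 'a::comm_ring_1"
  defines "contract \<equiv> \<lambda>j (c :: 'i set \<Rightarrow> 'a) \<sigma>.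
    if j \<in> \<sigma> then 0 else ksign j (insert j \<sigma>) * c (insert j \<sigma>)"
  shows "koszul y (contract j c) \<sigma> + contract j (koszul y c) \<sigma> = y j * c \<sigma>"
proof (cases "j \<in> \<sigma>")
  case True
  \<comment> \<open>\<open>contract j c\<close> vanishes on sets containing \<open>j\<close>, so
    only the summand that removes \<open>j\<close> survives.\<close>
  have "koszul y (contract j c) \<sigma>
      = (\<Sum>k\<in>\<sigma>. if k = j then ksign j \<sigma> * y j * (ksign j \<sigma> * c \<sigma>) else 0)"
    unfolding koszul_def contract_def using True
    by (intro sum.cong) (auto simp: insert_absorb)
  also have "\<dots> = y j * c \<sigma>"
    using True by (simp add: ksign_square_left mult.left_commute mult.assoc)
  finally show ?thesis
    using True by (simp add: contract_def)
next
  case False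
  have "koszul y c (insert j \<sigma>) = ksign j (insert j \<sigma>) * y j * c \<sigma>
      + (\<Sum>k\<in>\<sigma>. ksign k (insert j \<sigma>) * y k * c (insert j \<sigma> - {k}))"
    using False by (simp add: koszul_def)
  then have "contract j (koszul y c) \<sigma> = y j * c \<sigma>
      + (\<Sum>k\<in>\<sigma>. ksign j (insert j \<sigma>) * (ksign k (insert j \<sigma>) * y k * c (insert j \<sigma> - {k})))"
    using False by (simp add: contract_def distrib_left ksign_square_left sum_distrib_left mult.assoc)
  moreover have "ksign k \<sigma> * y k * contract j c (\<sigma> - {k})
      = - (ksign j (insert j \<sigma>) * (ksign k (insert j \<sigma>) * y k * c (insert j \<sigma> - {k})))"
    if "k \<in> \<sigma>" for k
  proof -
    let ?\<tau> = "insert j \<sigma>"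
    have kj: "k \<noteq> j" "?\<tau> - {j} = \<sigma>" "insert j (\<sigma> - {k}) = ?\<tau> - {k}"
      using that False by auto
    have "ksign j ?\<tau> * ksign k \<sigma> = - (ksign k ?\<tau> * ksign j (?\<tau> - {k}) :: 'a)"
      using ksign_swap[of ?\<tau> j k, where ?'a = 'a] that kj by auto
    then have "ksign j ?\<tau> * (ksign j ?\<tau> * ksign k \<sigma>)
        = ksign j ?\<tau> * - (ksign k ?\<tau> * ksign j (?\<tau> - {k}) :: 'a)"
      by (simp only:)
    then have "ksign k \<sigma> = - (ksign j ?\<tau> * ksign k ?\<tau> * ksign j (?\<tau> - {k}) :: 'a)"
      by (simp add: ksign_square_left mult.assoc)
    then have "ksign k \<sigma> * ksign j (?\<tau> - {k}) = - (ksign j ?\<tau> * ksign k ?\<tau> :: 'a)"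
      by (simp add: ksign_square mult.assoc)
    then have "ksign k \<sigma> * ksign j (?\<tau> - {k}) * (y k * c (?\<tau> - {k}))
        = - (ksign j ?\<tau> * ksign k ?\<tau>) * (y k * c (?\<tau> - {k}))"
      by (simp only:)
    then show ?thesis
      using False kj by (simp add: contract_def ac_simps)
  qed
  ultimately show ?thesis
    by (simp add: koszul_def[of y "contract j c"] sum_negf)
qed

section \<open>Regular sequences and Koszul cohomology\<close>

interpretation ring_module: module "(*) :: 'a::comm_ring_1 \<Rightarrow> 'a \<Rightarrow> 'a"
  by (rule module_ring_mult)

lemma subspace_quot_denom: "module.subspace (*) (quot_denom I N gs)"
  by (simp add: quot_denom_def)

lemma quot_denom_Nil:
  assumes "module.subspace (*) N"
  shows "quot_denom I N [] = N"
  using assms by (simp add: quot_denom_def)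

lemma quot_denom_singleton:
  assumes "module.subspace (*) I" "module.subspace (*) N"
  shows "quot_denom I N [g] = {n + g * a | n a. n \<in> N \<and> a \<in> I}"
proof -
  have "module.subspace (*) {g * a | a. a \<in> I}"
  proof (rule ring_module.subspaceI)
    show "0 \<in> {g * a | a. a \<in> I}"
      using ring_module.subspace_0[OF assms(1)] by force
    show "p + q \<in> {g * a | a. a \<in> I}" if "p \<in> {g * a | a. a \<in> I}" "q \<in> {g * a | a. a \<in> I}" for p q
      using that ring_module.subspace_add[OF assms(1)] by (auto simp flip: distrib_left)
    show "c * p \<in> {g * a | a. a \<in> I}" if "p \<in> {g * a | a. a \<in> I}" for c p
      using that ring_module.subspace_scale[OF assms(1)] by clarify (metis mult.left_commute)
  qed
  then have "ideal_gen {g * a | a. a \<in> I} = {g * a | a. a \<in> I}"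
    by (simp only: ring_module.span_eq_iff)
  moreover have "ideal_gen N = N"
    using assms(2) by simp
  moreover have "{h * a | h a. h \<in> set [g] \<and> a \<in> I} = {g * a | a. a \<in> I}"
    by simp
  ultimately have "quot_denom I N [g] = {p + q | p q. p \<in> N \<and> q \<in> {g * a | a. a \<in> I}}"
    unfolding quot_denom_def by (simp only: ring_module.span_Un)
  then show ?thesis
    by blast
qed

text \<open>Dividing by the whole sequence is dividing by \<open>g\<close> first; this drives the
  induction on regular sequences.\<close>

lemma quot_denom_Cons: "quot_denom I N (g # gs) = quot_denom I (quot_denom I N [g]) gs"
proof -
  have "{h * a | h a. h \<in> set (g # gs) \<and> a \<in> I}
      = {h * a | h a. h \<in> set [g] \<and> a \<in> I} \<union> {h * a | h a. h \<in> set gs \<and> a \<in> I}"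
    by auto
  moreover have "ideal_gen (A \<union> (B \<union> C)) = ideal_gen (ideal_gen (A \<union> B) \<union> C)" for A B C :: "'a set"
    by (simp only: Un_assoc[symmetric] ring_module.span_Un[of "A \<union> B"]
        ring_module.span_Un[of "ideal_gen (A \<union> B)"] ring_module.span_span)
  ultimately show ?thesis
    by (simp only: quot_denom_def)
qed

lemma regular_seq_Cons:
  assumes "module.subspace (*) N" "regular_seq I N (g # gs)"
  shows "\<And>a. a \<in> I \<Longrightarrow> g * a \<in> N \<Longrightarrow> a \<in> N" and "regular_seq I (quot_denom I N [g]) gs"
proof -
  have reg: "(g # gs) ! i * a \<in> quot_denom I N (take i (g # gs))
      \<Longrightarrow> a \<in> quot_denom I N (take i (g # gs))" if "i < length (g # gs)" "a \<in> I" for i a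
    using that assms(2) unfolding regular_seq_def by blast
  show "a \<in> N" if "a \<in> I" "g * a \<in> N" for a
    using reg[of 0 a] that quot_denom_Nil[OF assms(1)] by simp
  have "quot_denom I (quot_denom I N [g]) gs \<noteq> I"
    using assms(2) by (simp add: regular_seq_def quot_denom_Cons[of I N g gs])
  then show "regular_seq I (quot_denom I N [g]) gs"
    using reg[of "Suc i" for i] by (auto simp: regular_seq_def quot_denom_Cons[of I N g "take _ _"])
qed

section \<open>Koszul cohomology with coefficients in \<open>I/N\<close>\<close>

definition koszul_cocycle ::
    "'a::comm_ring_1 set \<Rightarrow> 'a set \<Rightarrow> ('i::finite \<Rightarrow> 'a) \<Rightarrow> nat \<Rightarrow> ('i set \<Rightarrow> 'a) \<Rightarrow> bool" where
  "koszul_cocycle I N y k z \<longleftrightarrow>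
     (\<forall>\<sigma>. z \<sigma> \<in> I) \<and> (\<forall>\<sigma>. card \<sigma> = Suc k \<longrightarrow> koszul y z \<sigma> \<in> N)"

text \<open>As in \<open>koszul_cocycle\<close>, cochains with values in \<open>I/N\<close> are
  represented by lifts to \<open>I\<close>. For \<open>k = 0\<close> the sum
  \<open>koszul y u {}\<close> is empty.\<close>

definition koszul_coboundary ::
    "'a::comm_ring_1 set \<Rightarrow> 'a set \<Rightarrow> ('i::finite \<Rightarrow> 'a) \<Rightarrow> nat \<Rightarrow> ('i set \<Rightarrow> 'a) \<Rightarrow> bool" where
  "koszul_coboundary I N y k z \<longleftrightarrow>
     (\<exists>u. (\<forall>\<rho>. u \<rho> \<in> I) \<and> (\<forall>\<sigma>. card \<sigma> = k \<longrightarrow> z \<sigma> - koszul y u \<sigma> \<in> N))"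

lemma koszul_in_subspace:
  assumes "module.subspace (*) I" "\<And>\<rho>. u \<rho> \<in> I"
  shows "koszul y u \<sigma> \<in> I"
  unfolding koszul_def
  by (intro ring_module.subspace_sum[OF assms(1)] ring_module.subspace_scale[OF assms(1)] assms(2))

lemma koszul_cocycle_mult:
  assumes "module.subspace (*) I" "module.subspace (*) N" "koszul_cocycle I N y k z"
  shows "koszul_cocycle I N y k (\<lambda>\<sigma>. a * z \<sigma>)"
  using assms(3) unfolding koszul_cocycle_def koszul_mult
  by (auto intro: ring_module.subspace_scale[OF assms(1)] ring_module.subspace_scale[OF assms(2)])

text \<open>The contraction of \<open>z\<close> is the witness; the other term of the homotopy
  formula is up to sign a value of the differential of \<open>z\<close>, hence in
  \<open>N\<close>.\<close>

lemma koszul_coboundary_multiplier: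
  assumes "module.subspace (*) I" "module.subspace (*) N" "koszul_cocycle I N y k z"
  shows "koszul_coboundary I N y k (\<lambda>\<sigma>. y j * z \<sigma>)"
  unfolding koszul_coboundary_def
proof (intro exI conjI allI impI)
  let ?u = "\<lambda>\<sigma>. if j \<in> \<sigma> then 0 else ksign j (insert j \<sigma>) * z (insert j \<sigma>)"
  show "?u \<rho> \<in> I" for \<rho>
    using assms(3) ring_module.subspace_0[OF assms(1)] ring_module.subspace_scale[OF assms(1)]
    by (auto simp: koszul_cocycle_def)
  fix \<sigma> :: "'b set" assume "card \<sigma> = k"
  then have "koszul y z (insert j \<sigma>) \<in> N" if "j \<notin> \<sigma>"
    using assms(3) that by (simp add: koszul_cocycle_def)
  moreover have "y j * z \<sigma> - koszul y ?u \<sigma>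
      = (if j \<in> \<sigma> then 0 else ksign j (insert j \<sigma>) * koszul y z (insert j \<sigma>))"
    using koszul_homotopy[of y j z \<sigma>] by (simp add: algebra_simps)
  ultimately show "y j * z \<sigma> - koszul y ?u \<sigma> \<in> N"
    using ring_module.subspace_0[OF assms(2)] ring_module.subspace_scale[OF assms(2)] by auto
qed

text \<open>The annihilator of a class is an ideal, so testing it on generators of an ideal
  suffices.\<close>

lemma subspace_coboundary_multipliers:
  assumes "module.subspace (*) I" "module.subspace (*) N"
  shows "module.subspace (*) {h. koszul_coboundary I N y k (\<lambda>\<sigma>. h * z \<sigma>)}"
proof (rule ring_module.subspaceI)
  have "koszul y (\<lambda>\<rho>. 0) \<sigma> = 0" for \<sigma>
    by (simp add: koszul_def)
  then show "0 \<in> {h. koszul_coboundary I N y k (\<lambda>\<sigma>. h * z \<sigma>)}"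
    unfolding koszul_coboundary_def mem_Collect_eq
    by (intro exI[of _ "\<lambda>_. 0"])
       (simp add: ring_module.subspace_0[OF assms(1)] ring_module.subspace_0[OF assms(2)])
next
  fix p q
  assume "p \<in> {h. koszul_coboundary I N y k (\<lambda>\<sigma>. h * z \<sigma>)}"
    and "q \<in> {h. koszul_coboundary I N y k (\<lambda>\<sigma>. h * z \<sigma>)}"
  then obtain u v where u: "\<And>\<rho>. u \<rho> \<in> I" "\<And>\<sigma>. card \<sigma> = k \<Longrightarrow> p * z \<sigma> - koszul y u \<sigma> \<in> N"
    and v: "\<And>\<rho>. v \<rho> \<in> I" "\<And>\<sigma>. card \<sigma> = k \<Longrightarrow> q * z \<sigma> - koszul y v \<sigma> \<in> N"
    by (auto simp: koszul_coboundary_def)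
  have "(p + q) * z \<sigma> - koszul y (\<lambda>\<rho>. u \<rho> + v \<rho>) \<sigma> \<in> N" if "card \<sigma> = k" for \<sigma>
    using ring_module.subspace_add[OF assms(2) u(2)[OF that] v(2)[OF that]]
    by (simp only: koszul_add distrib_right add_diff_add)
  then show "p + q \<in> {h. koszul_coboundary I N y k (\<lambda>\<sigma>. h * z \<sigma>)}"
    unfolding koszul_coboundary_def mem_Collect_eq
    by (intro exI[of _ "\<lambda>\<rho>. u \<rho> + v \<rho>"]) (simp add: ring_module.subspace_add[OF assms(1)] u(1) v(1))
next
  fix c p
  assume "p \<in> {h. koszul_coboundary I N y k (\<lambda>\<sigma>. h * z \<sigma>)}"
  then obtain u where u: "\<And>\<rho>. u \<rho> \<in> I" "\<And>\<sigma>. card \<sigma> = k \<Longrightarrow> p * z \<sigma> - koszul y u \<sigma> \<in> N"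
    by (auto simp: koszul_coboundary_def)
  have "c * p * z \<sigma> - koszul y (\<lambda>\<rho>. c * u \<rho>) \<sigma> \<in> N" if "card \<sigma> = k" for \<sigma>
    using ring_module.subspace_scale[OF assms(2) u(2)[OF that], of c]
    by (simp only: koszul_mult right_diff_distrib mult.assoc)
  then show "c * p \<in> {h. koszul_coboundary I N y k (\<lambda>\<sigma>. h * z \<sigma>)}"
    unfolding koszul_coboundary_def mem_Collect_eq
    by (intro exI[of _ "\<lambda>\<rho>. c * u \<rho>"]) (simp add: ring_module.subspace_scale[OF assms(1)] u(1))
qed

text \<open>A nonzero Koszul class on the squares of the \<open>x j\<close> has a nonzero multiple that is killed
  by every \<open>x j\<close>: multiply by the product of a maximal set of \<open>x j\<close> that keeps it nonzero.\<close>

lemma koszul_socle: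
  fixes x :: "'i::finite \<Rightarrow> 'a::comm_ring_1"
  assumes "module.subspace (*) I" "module.subspace (*) N"
    and z: "koszul_cocycle I N (\<lambda>j. (x j)\<^sup>2) k z" "\<not> koszul_coboundary I N (\<lambda>j. (x j)\<^sup>2) k z"
  obtains z' where "koszul_cocycle I N (\<lambda>j. (x j)\<^sup>2) k z'"
    and "\<not> koszul_coboundary I N (\<lambda>j. (x j)\<^sup>2) k z'"
    and "\<And>g. g \<in> ideal_gen (range x) \<Longrightarrow> koszul_coboundary I N (\<lambda>j. (x j)\<^sup>2) k (\<lambda>\<sigma>. g * z' \<sigma>)"
proof -
  let ?cob = "koszul_coboundary I N (\<lambda>j. (x j)\<^sup>2) k"
  define \<T> where "\<T> = {T. \<not> ?cob (\<lambda>\<sigma>. prod x T * z \<sigma>)}"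
  have "{} \<in> \<T>"
    using z(2) by (simp add: \<T>_def)
  then have "\<T> \<noteq> {}"
    by blast
  from finite_has_maximal[OF finite this]
  obtain T where T: "T \<in> \<T>" "\<And>T'. T' \<in> \<T> \<Longrightarrow> T \<subseteq> T' \<Longrightarrow> T = T'"
    by blast
  let ?z = "\<lambda>\<sigma>. prod x T * z \<sigma>"
  have "?cob (\<lambda>\<sigma>. x j * ?z \<sigma>)" for j
  \<comment> \<open>For \<open>j\<close> in \<open>T\<close> a second factor \<open>x j\<close>
    completes a square, which annihilates cohomology; otherwise the maximality of \<open>T\<close>
    applies.\<close>
  proof (cases "j \<in> T")
    case True
    have "prod x T = x j * prod x (T - {j})"
      by (rule prod.remove[OF finite True])
    then have *: "x j * ?z \<sigma> = (x j)\<^sup>2 * (prod x (T - {j}) * z \<sigma>)" for \<sigma>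
      by (simp only: power2_eq_square mult.assoc)
    show ?thesis
      unfolding *
      by (rule koszul_coboundary_multiplier[OF assms(1,2) koszul_cocycle_mult[OF assms(1,2) z(1)]])
  next
    case False
    then have "insert j T \<notin> \<T>"
      using T(2)[of "insert j T"] by blast
    then have "?cob (\<lambda>\<sigma>. prod x (insert j T) * z \<sigma>)"
      by (simp only: \<T>_def mem_Collect_eq not_not)
    then show ?thesis
      by (simp only: prod.insert[OF finite False] mult.assoc)
  qed
  then have "range x \<subseteq> {h. ?cob (\<lambda>\<sigma>. h * ?z \<sigma>)}"
    by auto
  then have "ideal_gen (range x) \<subseteq> {h. ?cob (\<lambda>\<sigma>. h * ?z \<sigma>)}"
    by (rule ring_module.span_minimal) (rule subspace_coboundary_multipliers[OF assms(1,2)])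
  moreover have "\<not> ?cob ?z"
    using T(1) by (simp add: \<T>_def)
  ultimately show thesis
    by (intro that[OF koszul_cocycle_mult[OF assms(1,2) z(1)]]) blast+
qed

text \<open>The connecting homomorphism of \<open>0 \<rightarrow> I/N \<rightarrow> I/N \<rightarrow> I/(N + gI) \<rightarrow> 0\<close>: if \<open>g z\<close> is the
  coboundary of \<open>u\<close> modulo \<open>N\<close>, then \<open>u\<close> is a cocycle modulo \<open>N + gI\<close>.\<close>

lemma koszul_connecting:
  assumes "module.subspace (*) I" "module.subspace (*) N"
    and z: "koszul_cocycle I N y k z" "\<not> koszul_coboundary I N y k z"
    and g: "koszul_coboundary I N y k (\<lambda>\<sigma>. g * z \<sigma>)"
    and reg: "\<And>a. a \<in> I \<Longrightarrow> g * a \<in> N \<Longrightarrow> a \<in> N"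
  obtains k' u where "k = Suc k'" "koszul_cocycle I (quot_denom I N [g]) y k' u"
    "\<not> koszul_coboundary I (quot_denom I N [g]) y k' u"
proof -
  note sub = ring_module.subspace_diff ring_module.subspace_add ring_module.subspace_scale
    ring_module.subspace_0
  note quot = quot_denom_singleton[OF assms(1,2)]
  obtain u where u: "\<And>\<rho>. u \<rho> \<in> I" "\<And>\<sigma>. card \<sigma> = k \<Longrightarrow> g * z \<sigma> - koszul y u \<sigma> \<in> N"
    using g by (auto simp: koszul_coboundary_def)
  have zI: "z \<sigma> \<in> I" for \<sigma>
    using z(1) by (simp add: koszul_cocycle_def)
  obtain k' where k: "k = Suc k'"
  proof (cases k)
    \<comment> \<open>The differential of \<open>u\<close> at \<open>{}\<close> is an empty sum, so
      \<open>g * z {} \<in> N\<close>, and \<open>reg\<close> makes \<open>z\<close> a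
      coboundary.\<close>
    case 0
    have "z {} - koszul y (\<lambda>_. 0) {} \<in> N"
      using reg[OF zI, of "{}"] u(2)[of "{}"] 0 by (simp add: koszul_def)
    then have "koszul_coboundary I N y k z"
      unfolding koszul_coboundary_def using 0 sub(4)[OF assms(1)]
      by (intro exI[of _ "\<lambda>_. 0"]) auto
    with z(2) show thesis
      by blast
  qed
  have "koszul_cocycle I (quot_denom I N [g]) y k' u"
    unfolding koszul_cocycle_def
  proof (intro conjI allI impI u(1))
    fix \<sigma> :: "'b set" assume "card \<sigma> = Suc k'"
    then have "koszul y u \<sigma> - g * z \<sigma> \<in> N"
      using ring_module.subspace_neg[OF assms(2) u(2)[of \<sigma>]] k by simp
    moreover have "koszul y u \<sigma> = (koszul y u \<sigma> - g * z \<sigma>) + g * z \<sigma>"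
      by simp
    ultimately show "koszul y u \<sigma> \<in> quot_denom I N [g]"
      unfolding quot using zI by blast
  qed
  moreover have "\<not> koszul_coboundary I (quot_denom I N [g]) y k' u"
  proof
    assume "koszul_coboundary I (quot_denom I N [g]) y k' u"
    then obtain w where w: "\<And>\<rho>. w \<rho> \<in> I"
      "\<And>\<sigma>. card \<sigma> = k' \<Longrightarrow> u \<sigma> - koszul y w \<sigma> \<in> quot_denom I N [g]"
      by (auto simp: koszul_coboundary_def)
    \<comment> \<open>The elements \<open>a\<close> form the cochain \<open>v\<close> with
      \<open>u = koszul y w + g * v\<close> modulo \<open>N\<close>. Off the sets of size
      \<open>k'\<close> any element of \<open>I\<close> will do.\<close>
    have "\<exists>a. a \<in> I \<and> (card \<sigma> = k' \<longrightarrow> u \<sigma> - koszul y w \<sigma> - g * a \<in> N)" for \<sigma>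
    proof (cases "card \<sigma> = k'")
      case True
      then obtain n a where "n \<in> N" "a \<in> I" "u \<sigma> - koszul y w \<sigma> = n + g * a"
        using w(2) unfolding quot by blast
      then show ?thesis
        by (intro exI[of _ a]) simp
    qed (use zI in blast)
    then have "\<exists>v. \<forall>\<sigma>. v \<sigma> \<in> I \<and> (card \<sigma> = k' \<longrightarrow> u \<sigma> - koszul y w \<sigma> - g * v \<sigma> \<in> N)"
      by (rule choice[OF allI])
    then obtain v where v: "\<And>\<sigma>. v \<sigma> \<in> I"
      "\<And>\<sigma>. card \<sigma> = k' \<Longrightarrow> u \<sigma> - koszul y w \<sigma> - g * v \<sigma> \<in> N"
      by blast
    have "z \<sigma> - koszul y v \<sigma> \<in> N" if "card \<sigma> = k" for \<sigma>
    proof (rule reg)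
      show "z \<sigma> - koszul y v \<sigma> \<in> I"
        by (intro sub(1)[OF assms(1)] zI koszul_in_subspace[OF assms(1)] v(1))
      \<comment> \<open>The differential of \<open>u = koszul y w + g * v + ?n\<close> loses its
        first term, so \<open>g * (z - koszul y v)\<close> equals
        \<open>(g * z - koszul y u) + koszul y ?n\<close>, which lies in \<open>N\<close>.\<close>
      let ?n = "\<lambda>\<rho>. u \<rho> - koszul y w \<rho> - g * v \<rho>"
      have "koszul y ?n \<sigma> \<in> N"
        unfolding koszul_def[of y ?n]
        using that k by (intro ring_module.subspace_sum[OF assms(2)] sub(3)[OF assms(2)] v(2)) auto
      moreover have "koszul y u \<sigma> = koszul y (\<lambda>\<rho>. koszul y w \<rho> + (g * v \<rho> + ?n \<rho>)) \<sigma>"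
        by simp
      then have "koszul y u \<sigma> = g * koszul y v \<sigma> + koszul y ?n \<sigma>"
        unfolding koszul_add koszul_mult koszul_koszul by simp
      ultimately show "g * (z \<sigma> - koszul y v \<sigma>) \<in> N"
        using sub(2)[OF assms(2) u(2)[OF that], of "koszul y ?n \<sigma>"] by (simp add: algebra_simps)
    qed
    with v(1) have "koszul_coboundary I N y k z"
      by (auto simp: koszul_coboundary_def)
    with z(2) show False ..
  qed
  ultimately show thesis
    using that k by blast
qed

text \<open>By \<open>koszul_socle\<close> the class may be taken to be killed by the first element
  of the sequence; \<open>koszul_connecting\<close> then yields a nonzero class one degree lower
  over the quotient. Each element costs one degree.\<close>

theorem length_regular_seq_le_koszul:
  fixes x :: "'i::finite \<Rightarrow> 'a::comm_ring_1"
  assumes "module.subspace (*) I" "module.subspace (*) N"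
    and "koszul_cocycle I N (\<lambda>j. (x j)\<^sup>2) k z" "\<not> koszul_coboundary I N (\<lambda>j. (x j)\<^sup>2) k z"
    and "set gs \<subseteq> ideal_gen (range x)" "regular_seq I N gs"
  shows "length gs \<le> k"
  using assms(2-)
proof (induction gs arbitrary: N k z)
  case (Cons g gs)
  obtain z' where z': "koszul_cocycle I N (\<lambda>j. (x j)\<^sup>2) k z'"
    "\<not> koszul_coboundary I N (\<lambda>j. (x j)\<^sup>2) k z'"
    "koszul_coboundary I N (\<lambda>j. (x j)\<^sup>2) k (\<lambda>\<sigma>. g * z' \<sigma>)"
    using koszul_socle[OF assms(1) Cons.prems(1-3)] Cons.prems(4) by (metis insert_subset list.set(2))
  note reg = regular_seq_Cons[OF Cons.prems(1,5)]
  obtain k' u where "k = Suc k'" "koszul_cocycle I (quot_denom I N [g]) (\<lambda>j. (x j)\<^sup>2) k' u"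
    "\<not> koszul_coboundary I (quot_denom I N [g]) (\<lambda>j. (x j)\<^sup>2) k' u"
    using koszul_connecting[OF assms(1) Cons.prems(1) z' reg(1)] by blast
  then show ?case
    using Cons.IH[OF subspace_quot_denom] Cons.prems(4) reg(2) by simp
qed simp

section \<open>Monomial ideals as families of sets\<close>

abbreviation vars :: "'n monomial \<Rightarrow> 'n set" where
  "vars u \<equiv> Poly_Mapping.keys u"

lemma mdvd_iff: "mdvd u v \<longleftrightarrow> (\<forall>i. Poly_Mapping.lookup u i \<le> Poly_Mapping.lookup v i)"
proof
  assume "\<forall>i. Poly_Mapping.lookup u i \<le> Poly_Mapping.lookup v i"
  then have "v = u + (v - u)"
    by (intro poly_mapping_eqI) (simp add: lookup_add lookup_minus)
  then show "mdvd u v"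
    unfolding mdvd_def ..
qed (auto simp: mdvd_def lookup_add)

lemma squarefree_mon_lookup:
  assumes "squarefree_mon u"
  shows "Poly_Mapping.lookup u i = (if i \<in> vars u then 1 else 0)"
proof -
  have "Poly_Mapping.lookup u i \<le> 1"
    using assms by (simp add: squarefree_mon_def)
  then show ?thesis
    by (auto simp: in_keys_iff)
qed

lemma mdvd_squarefree_iff:
  assumes "squarefree_mon u"
  shows "mdvd u v \<longleftrightarrow> vars u \<subseteq> vars v"
proof -
  have "i \<in> vars v \<longleftrightarrow> 1 \<le> Poly_Mapping.lookup v i" for i
    by (simp add: in_keys_iff Suc_le_eq)
  then show ?thesis
    unfolding mdvd_iff squarefree_mon_lookup[OF assms] subset_eq by auto
qed

lemma squarefree_mon_eqI:
  assumes "squarefree_mon u" "squarefree_mon v" "vars u = vars v"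
  shows "u = v"
  using assms by (intro poly_mapping_eqI) (simp add: squarefree_mon_lookup)

lemma mdeg_squarefree: "squarefree_mon u \<Longrightarrow> mdeg u = card (vars u)"
  by (simp add: mdeg_def squarefree_mon_lookup sum.If_cases)

lemma mdeg_mono: "mdvd u v \<Longrightarrow> mdeg u \<le> mdeg v"
  unfolding mdvd_iff mdeg_def by (intro sum_mono) auto

lemma vars_mlcm: "vars (mlcm u v) = vars u \<union> vars v"
  by (auto simp: in_keys_iff mlcm.rep_eq max_def split: if_splits)

lemma squarefree_mon_mlcm: "squarefree_mon u \<Longrightarrow> squarefree_mon v \<Longrightarrow> squarefree_mon (mlcm u v)"
  by (simp add: squarefree_mon_def mlcm.rep_eq)

lemma poly_mapping_eq_sum_single:
  "p = (\<Sum>m\<in>Poly_Mapping.keys p. Poly_Mapping.single m (Poly_Mapping.lookup p m))"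
  by (intro poly_mapping_eqI) (auto simp: lookup_sum lookup_single when_def in_keys_iff)

lemma single_sum: "Poly_Mapping.single m (sum a A) = (\<Sum>j\<in>A. Poly_Mapping.single m (a j))"
  by (induction A rule: infinite_finite_induct) (simp_all add: single_add)

text \<open>The right side is a submodule containing the generators, and each term of one of its
  members is a multiple of a generator.\<close>

lemma ideal_gen_mon:
  fixes G :: "'n monomial set"
  shows "ideal_gen (mon ` G) =
    {p :: ('n, 'k::field) mpoly. \<forall>m\<in>Poly_Mapping.keys p. \<exists>u\<in>G. mdvd u m}" (is "_ = ?R")
proof
  have "module.subspace (*) ?R"
  proof (rule ring_module.subspaceI)
    show "p + q \<in> ?R" if "p \<in> ?R" "q \<in> ?R" for p q
      using that keys_add[of p q] by auto
    show "c * p \<in> ?R" if p: "p \<in> ?R" for c p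
    proof (clarify)
      fix m assume "m \<in> Poly_Mapping.keys (c * p)"
      then obtain a b where "b \<in> Poly_Mapping.keys p" "m = a + b"
        using keys_mult[of c p] by auto
      moreover obtain u where "u \<in> G" "mdvd u b"
        using p \<open>b \<in> _\<close> by blast
      ultimately show "\<exists>u\<in>G. mdvd u m"
        by (auto simp: mdvd_iff lookup_add intro!: bexI[of _ u] trans_le_add2)
    qed
  qed simp
  moreover have "mon ` G \<subseteq> ?R"
    by (auto simp: mon_def mdvd_iff)
  ultimately show "ideal_gen (mon ` G) \<subseteq> ?R"
    by (intro ring_module.span_minimal)
next
  show "?R \<subseteq> ideal_gen (mon ` G)"
  proof
    fix p :: "('n, 'k) mpoly" assume p: "p \<in> ?R"
    have "Poly_Mapping.single m (Poly_Mapping.lookup p m) \<in> ideal_gen (mon ` G)"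
      if m: "m \<in> Poly_Mapping.keys p" for m
    proof -
      obtain u w where u: "u \<in> G" "m = u + w"
        using p m by (auto simp: mdvd_def)
      then have "Poly_Mapping.single m (Poly_Mapping.lookup p m)
          = Poly_Mapping.single w (Poly_Mapping.lookup p m) * mon u"
        by (simp add: mon_def mult_single add.commute)
      then show ?thesis
        using u(1) by (metis image_eqI ring_module.span_base ring_module.span_scale)
    qed
    then show "p \<in> ideal_gen (mon ` G)"
      by (subst poly_mapping_eq_sum_single[of p]) (rule ring_module.span_sum)
  qed
qed

lemma mon_in_ideal_gen:
  "(mon u :: ('n, 'k::field) mpoly) \<in> ideal_gen (mon ` G) \<longleftrightarrow> (\<exists>v\<in>G. mdvd v u)"
  unfolding ideal_gen_mon by (simp add: mon_def)

section \<open>Squarefree monomial ideals from up-closed families of supports\<close>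

definition support_ideal :: "'n set set \<Rightarrow> ('n, 'k::field) mpoly set" where
  "support_ideal \<S> = {p. \<forall>m\<in>Poly_Mapping.keys p. vars m \<in> \<S>}"

definition up_closed :: "'n set set \<Rightarrow> bool" where
  "up_closed \<S> \<longleftrightarrow> (\<forall>S\<in>\<S>. \<forall>T. S \<subseteq> T \<longrightarrow> T \<in> \<S>)"

lemma up_closedD: "up_closed \<S> \<Longrightarrow> S \<in> \<S> \<Longrightarrow> S \<subseteq> T \<Longrightarrow> T \<in> \<S>"
  by (auto simp: up_closed_def)

lemma ideal_gen_squarefree:
  assumes "\<forall>u\<in>G. squarefree_mon u"
  shows "ideal_gen (mon ` G) = support_ideal {S. \<exists>u\<in>G. vars u \<subseteq> S}"
  using assms by (auto simp: ideal_gen_mon support_ideal_def mdvd_squarefree_iff)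

lemma mon_in_support_ideal: "mon u \<in> support_ideal \<S> \<longleftrightarrow> vars u \<in> \<S>"
  by (simp add: support_ideal_def mon_def)

lemma single_in_support_ideal: "vars m \<in> \<S> \<Longrightarrow> Poly_Mapping.single m a \<in> support_ideal \<S>"
  by (auto simp: support_ideal_def)

lemma lookup_support_ideal:
  "p \<in> support_ideal \<S> \<Longrightarrow> vars m \<notin> \<S> \<Longrightarrow> Poly_Mapping.lookup p m = 0"
  by (auto simp: support_ideal_def in_keys_iff)

lemma subspace_support_ideal:
  assumes "up_closed \<S>"
  shows "module.subspace (*) (support_ideal \<S> :: ('n, 'k::field) mpoly set)"
proof (rule ring_module.subspaceI)
  show "p + q \<in> support_ideal \<S>" if "p \<in> support_ideal \<S>" "q \<in> support_ideal \<S>"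
    for p q :: "('n, 'k) mpoly"
    using that keys_add[of p q] by (auto simp: support_ideal_def)
  show "c * p \<in> support_ideal \<S>" if "p \<in> support_ideal \<S>" for c p :: "('n, 'k) mpoly"
  proof -
    have "vars (a + b) \<in> \<S>" if "b \<in> Poly_Mapping.keys p" for a b
    proof (rule up_closedD[OF assms])
      show "vars b \<in> \<S>"
        using that \<open>p \<in> _\<close> by (auto simp: support_ideal_def)
      show "vars b \<subseteq> vars (a + b)"
        by (auto simp: in_keys_iff lookup_add)
    qed
    then show ?thesis
      using keys_mult[of c p] by (auto simp: support_ideal_def)
  qed
qed (simp add: support_ideal_def)

text \<open>The exponent \<open>2\<close> outside \<open>\<tau>\<close> and \<open>1\<close> on \<open>\<tau>\<close> makes the Koszul complex on the squares of
  the variables see, in the degrees \<open>twist_mon \<tau> \<sigma>\<close>, the relative cochain complex of the link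
  of \<open>\<tau>\<close>, that is, the local cohomology of \<open>I/J\<close> in degree \<open>- \<tau>\<close>.\<close>

definition twist_mon :: "'n set \<Rightarrow> 'n set \<Rightarrow> 'n monomial" where
  "twist_mon \<tau> \<sigma> = (\<Sum>i\<in>\<sigma>. Poly_Mapping.single i (if i \<in> \<tau> then 1 else 2))"

lemma lookup_twist_mon:
  "Poly_Mapping.lookup (twist_mon \<tau> \<sigma> :: 'n::finite monomial) i =
     (if i \<in> \<sigma> then if i \<in> \<tau> then 1 else 2 else 0)"
  by (simp add: twist_mon_def lookup_sum lookup_single when_def)

lemma vars_twist_mon: "vars (twist_mon \<tau> \<sigma> :: 'n::finite monomial) = \<sigma>"
  by (auto simp: in_keys_iff lookup_twist_mon split: if_splits)

lemma twist_mon_remove: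
  assumes "j \<in> \<sigma>" "j \<notin> \<tau>"
  shows "twist_mon \<tau> \<sigma> = Poly_Mapping.single j 2 + (twist_mon \<tau> (\<sigma> - {j}) :: 'n::finite monomial)"
  using assms by (simp add: twist_mon_def sum.remove[OF finite assms(1)])

lemma mon_var_square: "(mon (Poly_Mapping.single j 1))\<^sup>2 = mon (Poly_Mapping.single j 2)"
  by (simp add: mon_def power2_eq_square mult_single numeral_2_eq_2 flip: single_add)

lemma lookup_ksign_mult:
  "Poly_Mapping.lookup (ksign j \<sigma> * p) m = ksign j \<sigma> * Poly_Mapping.lookup p m"
  for p :: "('n, 'k::field) mpoly"
  by (simp add: ksign_def minus_one_power_iff)

lemma ksign_single: "ksign j \<sigma> * Poly_Mapping.single m a = Poly_Mapping.single m (ksign j \<sigma> * a)"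
  for m :: "'n monomial" and a :: "'k::field"
  by (simp add: ksign_def minus_one_power_iff single_uminus)

lemma lookup_mon_mult:
  "Poly_Mapping.lookup (mon u * p) (u + m) = Poly_Mapping.lookup p m"
  for p :: "('n, 'k::field) mpoly"
proof -
  have "mon u * p = (\<Sum>w\<in>Poly_Mapping.keys p. Poly_Mapping.single (u + w) (Poly_Mapping.lookup p w))"
    by (subst poly_mapping_eq_sum_single[of p]) (simp add: sum_distrib_left mon_def mult_single)
  then show ?thesis
    by (auto simp: lookup_sum lookup_single when_def in_keys_iff)
qed

lemma lookup_mon_mult_not_mdvd:
  fixes p :: "('n, 'k::field) mpoly"
  assumes "\<not> mdvd u m"
  shows "Poly_Mapping.lookup (mon u * p) m = 0"
proof (rule ccontr)
  assume "Poly_Mapping.lookup (mon u * p) m \<noteq> 0"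
  then have "m \<in> Poly_Mapping.keys (mon u * p)"
    by (simp add: in_keys_iff)
  then obtain b where "m = u + b"
    using keys_mult[of "mon u" p] by (auto simp: mon_def)
  with assms show False
    by (auto simp: mdvd_def)
qed

text \<open>Place \<open>c \<sigma>\<close> at the monomial
  \<open>twist_mon \<tau> \<sigma>\<close>. The square of variable \<open>j\<close> carries the
  monomial of \<open>\<sigma> - {j}\<close> to that of \<open>\<sigma>\<close> exactly when
  \<open>j\<close> is outside \<open>\<tau>\<close>, so cocycles stay cocycles, and reading off
  coefficients turns a Koszul primitive into a primitive of \<open>c\<close>.\<close>

theorem depth_le_cochain_class:
  fixes c :: "'n::finite set \<Rightarrow> 'k::field"
  assumes up: "up_closed \<I>" "up_closed \<J>"
    and supp: "\<And>\<sigma>. c \<sigma> \<noteq> 0 \<Longrightarrow> \<tau> \<subseteq> \<sigma> \<and> \<sigma> \<in> \<I>"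
    and cocycle: "\<And>\<sigma>. card \<sigma> = Suc k \<Longrightarrow> \<tau> \<subseteq> \<sigma> \<Longrightarrow> \<sigma> \<in> \<I> - \<J> \<Longrightarrow>
      (\<Sum>j\<in>\<sigma> - \<tau>. ksign j \<sigma> * c (\<sigma> - {j})) = 0"
    and noncob: "\<And>y. (\<And>\<rho>. \<rho> \<notin> \<I> \<Longrightarrow> y \<rho> = 0) \<Longrightarrow>
      \<exists>\<sigma>\<in>\<I> - \<J>. card \<sigma> = k \<and> \<tau> \<subseteq> \<sigma> \<and> c \<sigma> \<noteq> (\<Sum>j\<in>\<sigma> - \<tau>. ksign j \<sigma> * y (\<sigma> - {j}))"
  shows "depth (support_ideal \<I>) (support_ideal \<J> :: ('n, 'k) mpoly set) \<le> enat k"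
proof -
  let ?I = "support_ideal \<I> :: ('n, 'k) mpoly set" and ?J = "support_ideal \<J> :: ('n, 'k) mpoly set"
  define x :: "'n \<Rightarrow> ('n, 'k) mpoly" where "x j = mon (Poly_Mapping.single j 1)" for j
  define z where "z \<sigma> = Poly_Mapping.single (twist_mon \<tau> \<sigma>) (c \<sigma>)" for \<sigma>
  note sub = subspace_support_ideal[OF up(1), where ?'k = 'k]
    subspace_support_ideal[OF up(2), where ?'k = 'k]
  have koszul_z: "koszul (\<lambda>j. (x j)\<^sup>2) z \<sigma>
      = Poly_Mapping.single (twist_mon \<tau> \<sigma>) (\<Sum>j\<in>\<sigma> - \<tau>. ksign j \<sigma> * c (\<sigma> - {j}))" for \<sigma>
  proof -
    have "koszul (\<lambda>j. (x j)\<^sup>2) z \<sigma> = (\<Sum>j\<in>\<sigma> - \<tau>. ksign j \<sigma> * (x j)\<^sup>2 * z (\<sigma> - {j}))"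
      unfolding koszul_def
    proof (rule sum.mono_neutral_right[OF finite])
      have "c (\<sigma> - {j}) = 0" if "j \<in> \<tau>" for j
        using supp[of "\<sigma> - {j}"] that by auto
      then have "z (\<sigma> - {j}) = 0" if "j \<in> \<tau>" for j
        using that by (simp add: z_def)
      then show "\<forall>j\<in>\<sigma> - (\<sigma> - \<tau>). ksign j \<sigma> * (x j)\<^sup>2 * z (\<sigma> - {j}) = 0"
        by auto
    qed auto
    also have "\<dots> = (\<Sum>j\<in>\<sigma> - \<tau>. Poly_Mapping.single (twist_mon \<tau> \<sigma>) (ksign j \<sigma> * c (\<sigma> - {j})))"
    proof (rule sum.cong[OF refl])
      fix j assume "j \<in> \<sigma> - \<tau>"
      then have "(x j)\<^sup>2 * z (\<sigma> - {j}) = Poly_Mapping.single (twist_mon \<tau> \<sigma>) (c (\<sigma> - {j}))"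
        unfolding x_def mon_var_square
        by (simp add: z_def twist_mon_remove[of j \<sigma> \<tau>] mon_def mult_single)
      then show "ksign j \<sigma> * (x j)\<^sup>2 * z (\<sigma> - {j})
          = Poly_Mapping.single (twist_mon \<tau> \<sigma>) (ksign j \<sigma> * c (\<sigma> - {j}))"
        by (simp only: mult.assoc ksign_single)
    qed
    finally show ?thesis
      by (simp only: single_sum)
  qed
  have "z \<sigma> \<in> ?I" for \<sigma>
    using supp[of \<sigma>] ring_module.subspace_0[OF sub(1)]
    by (cases "c \<sigma> = 0") (auto simp: z_def vars_twist_mon intro: single_in_support_ideal)
  moreover have "koszul (\<lambda>j. (x j)\<^sup>2) z \<sigma> \<in> ?J" if "card \<sigma> = Suc k" for \<sigma>
  proof (cases "\<sigma> \<in> \<J>")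
    case True
    then show ?thesis
      unfolding koszul_z by (intro single_in_support_ideal) (simp add: vars_twist_mon)
  next
    case False
    have "(\<Sum>j\<in>\<sigma> - \<tau>. ksign j \<sigma> * c (\<sigma> - {j})) = 0"
    proof (cases "\<tau> \<subseteq> \<sigma> \<and> \<sigma> \<in> \<I>")
      case True
      then show ?thesis
        using cocycle that False by blast
    next
      case notP: False
      \<comment> \<open>A nonzero value on a face would force
        \<open>\<tau> \<subseteq> \<sigma>\<close> and, by up-closedness,
        \<open>\<sigma> \<in> \<I>\<close>.\<close>
      have "c (\<sigma> - {j}) = 0" for j
      proof (rule ccontr)
        assume "c (\<sigma> - {j}) \<noteq> 0"
        then show False
          using supp[of "\<sigma> - {j}"] notP up_closedD[OF up(1), of "\<sigma> - {j}" \<sigma>] by auto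
      qed
      then show ?thesis
        by simp
    qed
    then show ?thesis
      unfolding koszul_z using ring_module.subspace_0[OF sub(2)] by simp
  qed
  ultimately have "koszul_cocycle ?I ?J (\<lambda>j. (x j)\<^sup>2) k z"
    by (simp add: koszul_cocycle_def)
  moreover have "\<not> koszul_coboundary ?I ?J (\<lambda>j. (x j)\<^sup>2) k z"
  proof
    assume "koszul_coboundary ?I ?J (\<lambda>j. (x j)\<^sup>2) k z"
    then obtain u where u: "\<And>\<rho>. u \<rho> \<in> ?I"
      "\<And>\<sigma>. card \<sigma> = k \<Longrightarrow> z \<sigma> - koszul (\<lambda>j. (x j)\<^sup>2) u \<sigma> \<in> ?J"
      by (auto simp: koszul_coboundary_def)
    define y where "y \<rho> = Poly_Mapping.lookup (u \<rho>) (twist_mon \<tau> \<rho>)" for \<rho>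
    have "y \<rho> = 0" if "\<rho> \<notin> \<I>" for \<rho>
      unfolding y_def by (rule lookup_support_ideal[OF u(1)]) (simp add: vars_twist_mon that)
    then obtain \<sigma> where \<sigma>: "\<sigma> \<in> \<I> - \<J>" "card \<sigma> = k"
      and ne: "c \<sigma> \<noteq> (\<Sum>j\<in>\<sigma> - \<tau>. ksign j \<sigma> * y (\<sigma> - {j}))"
      using noncob[of y] by blast
    let ?m = "twist_mon \<tau> \<sigma>"
    have "Poly_Mapping.lookup (z \<sigma> - koszul (\<lambda>j. (x j)\<^sup>2) u \<sigma>) ?m = 0"
      using \<sigma> by (intro lookup_support_ideal[OF u(2)]) (simp_all add: vars_twist_mon)
    then have "c \<sigma> = Poly_Mapping.lookup (koszul (\<lambda>j. (x j)\<^sup>2) u \<sigma>) ?m"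
      by (simp add: z_def lookup_minus)
    also have "\<dots> = (\<Sum>j\<in>\<sigma>. ksign j \<sigma> *
        Poly_Mapping.lookup (mon (Poly_Mapping.single j 2) * u (\<sigma> - {j})) ?m)"
      unfolding koszul_def x_def mon_var_square by (simp only: lookup_sum mult.assoc lookup_ksign_mult)
    also have "\<dots> = (\<Sum>j\<in>\<sigma> - \<tau>. ksign j \<sigma> *
        Poly_Mapping.lookup (mon (Poly_Mapping.single j 2) * u (\<sigma> - {j})) ?m)"
    proof (rule sum.mono_neutral_right[OF finite])
      show "\<forall>j\<in>\<sigma> - (\<sigma> - \<tau>). ksign j \<sigma> *
          Poly_Mapping.lookup (mon (Poly_Mapping.single j 2) * u (\<sigma> - {j})) ?m = 0"
      proof
        fix j assume "j \<in> \<sigma> - (\<sigma> - \<tau>)"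
        \<comment> \<open>For \<open>j\<close> in \<open>\<tau>\<close> the exponent of
          \<open>j\<close> in \<open>?m\<close> is only 1.\<close>
        then have "\<not> mdvd (Poly_Mapping.single j 2) ?m"
          by (auto simp: mdvd_iff lookup_twist_mon lookup_single intro!: exI[of _ j])
        then show "ksign j \<sigma> *
            Poly_Mapping.lookup (mon (Poly_Mapping.single j 2) * u (\<sigma> - {j})) ?m = 0"
          by (simp add: lookup_mon_mult_not_mdvd)
      qed
    qed auto
    also have "\<dots> = (\<Sum>j\<in>\<sigma> - \<tau>. ksign j \<sigma> * y (\<sigma> - {j}))"
    proof (rule sum.cong[OF refl])
      fix j assume "j \<in> \<sigma> - \<tau>"
      then have m: "?m = Poly_Mapping.single j 2 + twist_mon \<tau> (\<sigma> - {j})"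
        by (simp add: twist_mon_remove)
      show "ksign j \<sigma> * Poly_Mapping.lookup (mon (Poly_Mapping.single j 2) * u (\<sigma> - {j})) ?m
          = ksign j \<sigma> * y (\<sigma> - {j})"
        unfolding m lookup_mon_mult y_def ..
    qed
    finally show False
      using ne by blast
  qed
  ultimately have "length gs \<le> k" if "set gs \<subseteq> max_ideal" "regular_seq ?I ?J gs" for gs
    using length_regular_seq_le_koszul[OF sub, of x k z gs] that by (simp add: max_ideal_def x_def)
  then show ?thesis
    unfolding depth_def by (auto intro!: Sup_least)
qed

section \<open>Bounds on the depth\<close>

text \<open>The indicator of \<open>A\<close> on the vertices of the link of \<open>F\<close>, with
  the signs of a differential of a function concentrated at \<open>F\<close>. The sum has at most
  one term, as \<open>\<sigma> - F\<close> is a singleton.\<close>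

definition star_cochain :: "'n::finite set \<Rightarrow> 'n set \<Rightarrow> 'n set \<Rightarrow> 'k::field" where
  "star_cochain F A \<sigma> =
     (if F \<subseteq> \<sigma> \<and> card \<sigma> = Suc (card F) then \<Sum>a\<in>(\<sigma> - F) \<inter> A. ksign a \<sigma> else 0)"

lemma star_cochain_insert:
  assumes "a \<notin> F"
  shows "star_cochain F A (insert a F) = (if a \<in> A then ksign a (insert a F) else 0 :: 'k::field)"
proof -
  have "insert a F - F = {a}"
    using assms by auto
  then show ?thesis
    using assms by (auto simp: star_cochain_def)
qed

lemma star_cochain_nonzeroE:
  assumes "star_cochain F A \<sigma> \<noteq> (0 :: 'k::field)"
  obtains a where "\<sigma> = insert a F" "a \<notin> F" "a \<in> A"
proof -
  have F: "F \<subseteq> \<sigma>" "card \<sigma> = Suc (card F)"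
    using assms by (auto simp: star_cochain_def split: if_splits)
  then have "card (\<sigma> - F) = 1"
    by (simp add: card_Diff_subset)
  then obtain a where "\<sigma> - F = {a}"
    by (auto simp: card_1_singleton_iff)
  then have a: "\<sigma> = insert a F" "a \<notin> F"
    using F by auto
  moreover have "a \<in> A"
    using assms unfolding a(1) star_cochain_insert[OF a(2)] by (auto split: if_splits)
  ultimately show thesis
    using that by blast
qed

text \<open>The faces of \<open>F \<union> {p, q}\<close> contribute opposite signs, which cancel if
  \<open>p\<close> and \<open>q\<close> are both in \<open>A\<close> or both outside. The last
  assumption covers both orders of \<open>p\<close> and \<open>q\<close>.\<close>

lemma star_cochain_cocycle:
  assumes "F \<subseteq> \<sigma>" "card \<sigma> = Suc (Suc (card F))"
    and "\<And>p q. p \<notin> F \<Longrightarrow> q \<notin> F \<Longrightarrow> p \<noteq> q \<Longrightarrow> \<sigma> = insert p (insert q F) \<Longrightarrow> p \<in> A \<Longrightarrow> q \<in> A"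
  shows "(\<Sum>j\<in>\<sigma> - F. ksign j \<sigma> * star_cochain F A (\<sigma> - {j})) = (0 :: 'k::field)"
proof -
  have "card (\<sigma> - F) = 2"
    using assms(1,2) by (simp add: card_Diff_subset)
  then obtain p q where pq: "\<sigma> - F = {p, q}" "p \<noteq> q"
    by (auto simp: card_2_iff)
  then have \<sigma>: "p \<notin> F" "q \<notin> F" "\<sigma> = insert p (insert q F)" "\<sigma> = insert q (insert p F)"
    using assms(1) by auto
  have "p \<in> A \<longleftrightarrow> q \<in> A"
    using assms(3)[of p q] assms(3)[of q p] \<sigma> pq(2) by blast
  moreover have "\<sigma> - {p} = insert q F" "\<sigma> - {q} = insert p F"
    using \<sigma>(1-3) pq(2) by auto
  moreover have "ksign p \<sigma> * ksign q (\<sigma> - {p}) = - (ksign q \<sigma> * ksign p (\<sigma> - {q}) :: 'k)"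
    by (rule ksign_swap) (use pq(2) \<sigma>(3) in auto)
  ultimately show ?thesis
    unfolding pq(1) using pq(2) star_cochain_insert[OF \<sigma>(1), of A, where ?'k = 'k]
      star_cochain_insert[OF \<sigma>(2), of A, where ?'k = 'k] by simp
qed

section \<open>Classes at generators of degree \<open>d\<close> and at maximal sets\<close>

locale initial_degree =
  fixes \<I> \<J> :: "'n::finite set set" and d :: nat
  assumes up: "up_closed \<I>" "up_closed \<J>"
    and card_I: "\<And>S. S \<in> \<I> \<Longrightarrow> d \<le> card S"
    and card_J: "\<And>S. S \<in> \<J> \<Longrightarrow> d < card S"
begin

definition gens :: "'n set set" where
  "gens = {F \<in> \<I>. card F = d}"

lemma gens_subset: "gens \<subseteq> \<I> - \<J>"
  using card_J by (fastforce simp: gens_def)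

lemma poset_convex: "S \<in> \<I> \<Longrightarrow> S \<subseteq> T \<Longrightarrow> T \<subseteq> U \<Longrightarrow> U \<in> \<I> - \<J> \<Longrightarrow> T \<in> \<I> - \<J>"
  using up by (auto simp: up_closed_def)

text \<open>No set with fewer than \<open>d\<close> elements lies in \<open>\<I>\<close>, so nothing
  can bound in degree \<open>d\<close>: a nonzero kernel element is a nonzero class with
  \<open>\<tau> = {}\<close>.\<close>

lemma depth_le_kernel:
  fixes c :: "'n set \<Rightarrow> 'k::field"
  assumes "\<And>F. c F \<noteq> 0 \<Longrightarrow> F \<in> gens" "c F\<^sub>0 \<noteq> 0"
    and "\<And>b. b \<in> \<I> - \<J> \<Longrightarrow> card b = Suc d \<Longrightarrow> (\<Sum>j\<in>b. ksign j b * c (b - {j})) = 0"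
  shows "depth (support_ideal \<I>) (support_ideal \<J> :: ('n, 'k) mpoly set) \<le> enat d"
proof (rule depth_le_cochain_class[OF up, of c "{}"])
  have F\<^sub>0: "F\<^sub>0 \<in> gens"
    using assms(1,2) by blast
  show "\<exists>\<sigma>\<in>\<I> - \<J>. card \<sigma> = d \<and> {} \<subseteq> \<sigma> \<and> c \<sigma> \<noteq> (\<Sum>j\<in>\<sigma> - {}. ksign j \<sigma> * y (\<sigma> - {j}))"
    if y: "\<And>\<rho>. \<rho> \<notin> \<I> \<Longrightarrow> y \<rho> = 0" for y
  proof (intro bexI conjI)
    have "y (F\<^sub>0 - {j}) = 0" if "j \<in> F\<^sub>0" for j
    proof (rule y)
      have "card (F\<^sub>0 - {j}) < d"
        using F\<^sub>0 that card_Diff1_less[of F\<^sub>0 j] by (simp add: gens_def)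
      then show "F\<^sub>0 - {j} \<notin> \<I>"
        using card_I by force
    qed
    then show "c F\<^sub>0 \<noteq> (\<Sum>j\<in>F\<^sub>0 - {}. ksign j F\<^sub>0 * y (F\<^sub>0 - {j}))"
      using assms(2) by simp
  qed (use F\<^sub>0 gens_subset in \<open>auto simp: gens_def\<close>)
qed (use assms gens_subset in \<open>auto simp: gens_def\<close>)

text \<open>The indicator of \<open>b\<close> with \<open>\<tau> = b\<close>: no larger set of the
  poset tests the cocycle condition, and coboundaries at \<open>b\<close> are sums over the empty
  set \<open>b - b\<close>.\<close>

lemma depth_le_maximal:
  assumes "b \<in> \<I> - \<J>" and max: "\<And>e. e \<notin> b \<Longrightarrow> insert e b \<notin> \<I> - \<J>"
  shows "depth (support_ideal \<I>) (support_ideal \<J> :: ('n, 'k::field) mpoly set) \<le> enat (card b)"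
proof (rule depth_le_cochain_class[OF up, of "\<lambda>\<sigma>. if \<sigma> = b then 1 else 0" b])
  show "(\<Sum>j\<in>\<sigma> - b. ksign j \<sigma> * (if \<sigma> - {j} = b then 1 else 0)) = (0 :: 'k)"
    if \<sigma>: "card \<sigma> = Suc (card b)" "b \<subseteq> \<sigma>" "\<sigma> \<in> \<I> - \<J>" for \<sigma>
  proof -
    have "card (\<sigma> - b) = 1"
      using \<sigma> by (simp add: card_Diff_subset)
    then obtain e where "\<sigma> - b = {e}"
      by (auto simp: card_1_singleton_iff)
    then have "\<sigma> = insert e b" "e \<notin> b"
      using \<sigma>(2) by auto
    then show ?thesis
      using max \<sigma>(3) by blast
  qed
  show "\<exists>\<sigma>\<in>\<I> - \<J>. card \<sigma> = card b \<and> b \<subseteq> \<sigma> \<and>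
      (if \<sigma> = b then 1 else 0 :: 'k) \<noteq> (\<Sum>j\<in>\<sigma> - b. ksign j \<sigma> * y (\<sigma> - {j}))" for y
    using assms(1) by (intro bexI[of _ b]) auto
qed (use assms(1) in \<open>auto split: if_splits\<close>)

end

text \<open>On supports, \<open>linked\<close> expresses that
  \<open>B \<inter> (f_1, ..., f_r)\<close> is contained in \<open>W\<close>, and \<open>far\<close>
  that \<open>C \<inter> W\<close> is empty.\<close>

locale linked_generators = initial_degree +
  assumes d_pos: "1 \<le> d" and gens_nonempty: "gens \<noteq> {}"
    and linked: "\<And>b F. b \<in> \<I> - \<J> \<Longrightarrow> card b = Suc d \<Longrightarrow> F \<in> gens \<Longrightarrow> F \<subseteq> b \<Longrightarrow>
      \<exists>F\<in>gens. \<exists>F'\<in>gens. F \<noteq> F' \<and> b = F \<union> F'"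
    and far: "\<And>F F'. F \<in> gens \<Longrightarrow> F' \<in> gens \<Longrightarrow> card (F \<union> F') = Suc (Suc d) \<Longrightarrow> F \<union> F' \<notin> \<I> - \<J>"
begin

text \<open>By \<open>linked\<close>, the set \<open>insert a F\<close> contains a generator other
  than \<open>F\<close>; having \<open>d\<close> of the \<open>d + 1\<close> elements, it omits
  exactly one, some \<open>v\<close> in \<open>F\<close>.\<close>

lemma exchange:
  assumes "F \<in> gens" "a \<notin> F" "insert a F \<in> \<I> - \<J>"
  obtains v where "v \<in> F" "insert a (F - {v}) \<in> gens"
proof -
  have F: "card F = d"
    using assms(1) by (simp add: gens_def)
  have "\<exists>F\<^sub>1\<in>gens. F\<^sub>1 \<noteq> F \<and> F\<^sub>1 \<subseteq> insert a F"
    using linked[OF assms(3) _ assms(1)] F assms(2) by fastforce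
  then obtain F\<^sub>1 where F\<^sub>1: "F\<^sub>1 \<in> gens" "F\<^sub>1 \<noteq> F" "F\<^sub>1 \<subseteq> insert a F"
    by blast
  then have card: "card F\<^sub>1 = d"
    by (simp add: gens_def)
  have "a \<in> F\<^sub>1"
  proof (rule ccontr)
    assume "a \<notin> F\<^sub>1"
    then have "F\<^sub>1 \<subseteq> F"
      using F\<^sub>1(3) by auto
    then show False
      using F\<^sub>1(2) F card card_subset_eq[of F F\<^sub>1] by simp
  qed
  have "card (insert a F - F\<^sub>1) = 1"
    using F F\<^sub>1(3) card assms(2) by (simp add: card_Diff_subset)
  then obtain v where "insert a F - F\<^sub>1 = {v}"
    by (auto simp: card_1_singleton_iff)
  then have "v \<in> F" "F\<^sub>1 = insert a (F - {v})"
    using \<open>a \<in> F\<^sub>1\<close> F\<^sub>1(3) assms(2) by auto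
  then show thesis
    using that F\<^sub>1(1) by blast
qed

text \<open>The union of the two generators has \<open>d + 2\<close> elements, so \<open>far\<close>
  applies. Link vertices exchanged for different elements of \<open>F\<close> are thus never joined
  by an edge.\<close>

lemma cross:
  assumes "F \<in> gens" "a \<notin> F" "h \<notin> F" "a \<noteq> h" "v \<in> F" "w \<in> F" "v \<noteq> w"
    and "insert a (F - {v}) \<in> gens" "insert h (F - {w}) \<in> gens"
  shows "insert a (insert h F) \<notin> \<I> - \<J>"
proof -
  have "insert a (F - {v}) \<union> insert h (F - {w}) = insert a (insert h F)"
    using assms(5-7) by auto
  moreover have "card (insert a (insert h F)) = Suc (Suc d)"
    using assms(1-4) by (simp add: gens_def)
  ultimately show ?thesis
    using far[OF assms(8,9)] by simp
qed

text \<open>A \<open>b\<close> that can be extended contains at most two generators: exchanging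
  \<open>e\<close> into \<open>b - {a}\<close> removes some \<open>u\<close>, and
  \<open>cross\<close> forces every other generator \<open>b - {x}\<close> to have
  \<open>x = u\<close>.\<close>

lemma third_generator:
  assumes "card b = Suc d" "e \<notin> b" "insert e b \<in> \<I> - \<J>"
    and "a \<in> b" "v \<in> b" "w \<in> b" "v \<noteq> a" "w \<noteq> a"
    and "b - {a} \<in> gens" "b - {v} \<in> gens" "b - {w} \<in> gens"
  shows "v = w"
proof (rule ccontr)
  assume "v \<noteq> w"
  let ?F = "b - {a}"
  have "e \<notin> ?F" "insert e ?F \<in> \<I> - \<J>"
    using assms(2,9) poset_convex[of ?F "insert e ?F" "insert e b"] assms(3) by (auto simp: gens_def)
  then obtain u where u: "u \<in> ?F" "insert e (?F - {u}) \<in> gens"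
    using exchange[OF assms(9)] by blast
  have "x = u" if "x \<in> b" "x \<noteq> a" "b - {x} \<in> gens" for x
  proof (rule ccontr)
    assume "x \<noteq> u"
    have "insert a (?F - {x}) = b - {x}"
      using that assms(4) by auto
    then have "insert a (insert e ?F) \<notin> \<I> - \<J>"
      using that u \<open>x \<noteq> u\<close> assms(2,4) by (intro cross[OF assms(9), of a e x u]) auto
    moreover have "insert a (insert e ?F) = insert e b"
      using assms(4) by auto
    ultimately show False
      using assms(3) by simp
  qed
  then show False
    using assms \<open>v \<noteq> w\<close> by blast
qed

definition core_vertex :: "'a set \<Rightarrow> 'a \<Rightarrow> bool" where
  "core_vertex F v \<longleftrightarrow> v \<in> F \<and>
     (\<forall>a. a \<notin> F \<longrightarrow> insert a F \<in> \<I> - \<J> \<longrightarrow> insert a (F - {v}) \<in> gens)"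

text \<open>Without a common core the link of \<open>F\<close> is disconnected, which gives a class in degree \<open>d + 1\<close>.\<close>

lemma depth_le_no_core:
  assumes F: "F \<in> gens" and no_core: "\<And>v. \<not> core_vertex F v"
  shows "depth (support_ideal \<I>) (support_ideal \<J> :: ('a, 'k::field) mpoly set) \<le> enat (Suc d)"
proof -
  have card_F: "card F = d"
    using F by (simp add: gens_def)
  \<comment> \<open>Some element of \<open>F\<close> exists and is no core vertex, which supplies an
    extension of \<open>F\<close> in the poset.\<close>
  then have "F \<noteq> {}"
    using d_pos by auto
  then obtain a where a: "a \<notin> F" "insert a F \<in> \<I> - \<J>"
    using no_core by (auto simp: core_vertex_def)
  obtain v where v: "v \<in> F" "insert a (F - {v}) \<in> gens"
    using exchange[OF F a] by blast
  obtain h where h: "h \<notin> F" "insert h F \<in> \<I> - \<J>" "insert h (F - {v}) \<notin> gens"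
    using no_core[of v] v(1) by (auto simp: core_vertex_def)
  \<comment> \<open>\<open>A\<close> contains \<open>a\<close> but not \<open>h\<close>, and by
    \<open>cross\<close> no edge of the link leaves it.\<close>
  define A where "A = {a. insert a F \<in> \<I> - \<J> \<and> insert a (F - {v}) \<in> gens}"
  let ?c = "star_cochain F A :: 'a set \<Rightarrow> 'k"
  show ?thesis
  proof (rule depth_le_cochain_class[OF up, of ?c F])
    show "F \<subseteq> \<sigma> \<and> \<sigma> \<in> \<I>" if "?c \<sigma> \<noteq> 0" for \<sigma>
      using star_cochain_nonzeroE[OF that] by (auto simp: A_def)
    show "(\<Sum>j\<in>\<sigma> - F. ksign j \<sigma> * ?c (\<sigma> - {j})) = 0"
      if \<sigma>: "card \<sigma> = Suc (Suc d)" "F \<subseteq> \<sigma>" "\<sigma> \<in> \<I> - \<J>" for \<sigma>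
    proof (rule star_cochain_cocycle[OF \<sigma>(2)])
      fix p q assume pq: "p \<notin> F" "q \<notin> F" "p \<noteq> q" "\<sigma> = insert p (insert q F)" "p \<in> A"
      have q: "insert q F \<in> \<I> - \<J>"
        using poset_convex[of F "insert q F" \<sigma>] F \<sigma>(3) pq(4) by (auto simp: gens_def)
      obtain w where w: "w \<in> F" "insert q (F - {w}) \<in> gens"
        using exchange[OF F pq(2) q] by blast
      have "w = v"
        using cross[OF F pq(1,2,3) v(1) w(1) _ _ w(2)] pq(4,5) \<sigma>(3) by (auto simp: A_def)
      then show "q \<in> A"
        using q w(2) by (simp add: A_def)
    qed (simp add: \<sigma>(1) card_F)
    show "\<exists>\<sigma>\<in>\<I> - \<J>. card \<sigma> = Suc d \<and> F \<subseteq> \<sigma> \<and> ?c \<sigma> \<noteq> (\<Sum>j\<in>\<sigma> - F. ksign j \<sigma> * y (\<sigma> - {j}))" for y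
    proof (rule ccontr)
      assume *: "\<not> ?thesis"
      \<comment> \<open>With \<open>\<tau> = F\<close> a coboundary at \<open>insert p F\<close>
        sees only \<open>y F\<close>. Then \<open>h\<close> demands \<open>y F = 0\<close>, while
        \<open>a\<close> demands a nonzero value.\<close>
      have eq: "?c (insert p F) = ksign p (insert p F) * y F" if "p \<notin> F" "insert p F \<in> \<I> - \<J>" for p
      proof -
        have "insert p F - F = {p}" "insert p F - {p} = F" "card (insert p F) = Suc d"
          using that card_F by auto
        moreover have "?c (insert p F) = (\<Sum>j\<in>insert p F - F. ksign j (insert p F) * y (insert p F - {j}))"
          using * that(2) calculation(3) by blast
        ultimately show ?thesis
          by simp
      qed
      have "y F = 0"
        using eq[OF h(1,2)] h(3) star_cochain_insert[OF h(1), of A, where ?'k = 'k] ksign_nonzero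
        by (auto simp: A_def)
      then show False
        using eq[OF a] v(2) a star_cochain_insert[OF a(1), of A, where ?'k = 'k]
        by (simp add: A_def ksign_nonzero)
    qed
  qed
qed

text \<open>The key is that \<open>V\<close> is closed under adjacency. If \<open>p\<close> is in
  \<open>V\<close> and \<open>b = G \<union> {p, q}\<close>, the core property at \<open>p\<close>
  makes \<open>insert q G\<close> a generator, whose core vertex \<open>w\<close> makes
  \<open>b - {w}\<close> one; \<open>third_generator\<close> forces \<open>w = q\<close>.\<close>

lemma depth_le_core:
  assumes core: "\<And>F. F \<in> gens \<Longrightarrow> \<exists>v. core_vertex F v"
    and extensible: "\<And>b F. b \<in> \<I> - \<J> \<Longrightarrow> card b = Suc d \<Longrightarrow> F \<in> gens \<Longrightarrow> F \<subseteq> b \<Longrightarrow>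
      \<exists>e. e \<notin> b \<and> insert e b \<in> \<I> - \<J>"
  shows "depth (support_ideal \<I>) (support_ideal \<J> :: ('a, 'k::field) mpoly set) \<le> enat d"
proof -
  obtain F\<^sub>0 v\<^sub>0 where F\<^sub>0: "F\<^sub>0 \<in> gens" "core_vertex F\<^sub>0 v\<^sub>0"
    using gens_nonempty core by blast
  define G where "G = F\<^sub>0 - {v\<^sub>0}"
  define V where "V = {v. insert v G \<in> gens \<and> core_vertex (insert v G) v}"
  let ?c = "star_cochain G V :: 'a set \<Rightarrow> 'k"
  have G: "v\<^sub>0 \<notin> G" "insert v\<^sub>0 G = F\<^sub>0"
    using F\<^sub>0(2) by (auto simp: G_def core_vertex_def)
  then have card_G: "Suc (card G) = d"
    using F\<^sub>0(1) by (auto simp: gens_def)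
  show ?thesis
  proof (rule depth_le_kernel[of ?c F\<^sub>0])
    show "F \<in> gens" if "?c F \<noteq> 0" for F
      using star_cochain_nonzeroE[OF that] by (auto simp: V_def)
    show "?c F\<^sub>0 \<noteq> 0"
      using star_cochain_insert[OF G(1), of V, where ?'k = 'k] F\<^sub>0
      by (simp add: G(2) V_def ksign_nonzero)
    fix b assume b: "b \<in> \<I> - \<J>" "card b = Suc d"
    \<comment> \<open>Faces missing an element of \<open>G\<close> carry the value 0.\<close>
    have "(\<Sum>j\<in>b. ksign j b * ?c (b - {j})) = (\<Sum>j\<in>b - G. ksign j b * ?c (b - {j}))"
      by (rule sum.mono_neutral_right) (auto simp: star_cochain_def)
    also have "\<dots> = 0"
    proof (cases "G \<subseteq> b")
      case True
      then show ?thesis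
      proof (rule star_cochain_cocycle)
        fix p q assume pq: "p \<notin> G" "q \<notin> G" "p \<noteq> q" "b = insert p (insert q G)" "p \<in> V"
        have p: "insert p G \<in> gens" "core_vertex (insert p G) p"
          using pq(5) by (auto simp: V_def)
        have bs: "b - {p} = insert q G" "b - {q} = insert p G"
          unfolding pq(4) using pq(1-3) by auto
        have "insert q (insert p G) \<in> \<I> - \<J>"
          using b(1) pq(4) by (simp add: insert_commute)
        then have "insert q (insert p G - {p}) \<in> gens"
          using p(2) pq(2,3) by (auto simp: core_vertex_def)
        moreover have "insert p G - {p} = G"
          using pq(1) by auto
        ultimately have q: "insert q G \<in> gens"
          by simp
        obtain w where w: "core_vertex (insert q G) w"
          using core[OF q] by blast
        have wq: "w \<in> insert q G"
          using w by (simp add: core_vertex_def)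
        then have "w \<noteq> p" "p \<notin> insert q G"
          using pq(1,3) by auto
        then have "insert p (insert q G - {w}) \<in> gens"
          using w b(1) unfolding pq(4) core_vertex_def by blast
        moreover have "insert p (insert q G - {w}) = b - {w}"
          using \<open>w \<noteq> p\<close> unfolding pq(4) by blast
        ultimately have bw: "b - {w} \<in> gens"
          by simp
        have inb: "p \<in> b" "q \<in> b" "w \<in> b" "insert p G \<subseteq> b"
          using wq unfolding pq(4) by auto
        obtain e where e: "e \<notin> b" "insert e b \<in> \<I> - \<J>"
          using extensible[OF b p(1) inb(4)] by blast
        have "b - {p} \<in> gens" "b - {q} \<in> gens"
          using p(1) q by (simp_all only: bs)
        from third_generator[OF b(2) e inb(1-3) pq(3)[symmetric] \<open>w \<noteq> p\<close> this bw]
        have "q = w" .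
        then show "q \<in> V"
          using q w by (simp add: V_def)
      qed (simp add: b(2) card_G)
    next
      case False
      then show ?thesis
        by (intro sum.neutral) (auto simp: star_cochain_def)
    qed
    finally show "(\<Sum>j\<in>b. ksign j b * ?c (b - {j})) = 0" .
  qed
qed

theorem depth_le_Suc:
  "depth (support_ideal \<I>) (support_ideal \<J> :: ('a, 'k::field) mpoly set) \<le> enat (Suc d)"
proof -
  consider (no_core) "\<exists>F\<in>gens. \<forall>v. \<not> core_vertex F v"
    | (maximal) "\<exists>b\<in>\<I> - \<J>. card b = Suc d \<and> (\<forall>e. e \<notin> b \<longrightarrow> insert e b \<notin> \<I> - \<J>)"
    | (core) "\<forall>F\<in>gens. \<exists>v. core_vertex F v"
      "\<forall>b\<in>\<I> - \<J>. card b = Suc d \<longrightarrow> (\<exists>e. e \<notin> b \<and> insert e b \<in> \<I> - \<J>)"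
    by blast
  then show ?thesis
  proof cases
    case no_core
    then show ?thesis
      using depth_le_no_core by blast
  next
    case maximal
    then obtain b where "b \<in> \<I> - \<J>" "card b = Suc d" "\<And>e. e \<notin> b \<Longrightarrow> insert e b \<notin> \<I> - \<J>"
      by blast
    then show ?thesis
      using depth_le_maximal[of b] by simp
  next
    case core
    then have "depth (support_ideal \<I>) (support_ideal \<J> :: ('a, 'k) mpoly set) \<le> enat d"
      by (intro depth_le_core) blast+
    also have "\<dots> \<le> enat (Suc d)"
      by simp
    finally show ?thesis .
  qed
qed

end

section \<open>Bounds on the Stanley depth\<close>

context initial_degree
begin

text \<open>\<open>v\<close> is the matrix of the differential from \<open>d\<close>-sets to
  \<open>(d+1)\<close>-sets. Dependent rows give a kernel element; independent rows give a matching
  along nonzero entries, which require \<open>F \<subseteq> b\<close>.\<close>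

lemma depth_le_or_matching:
  "depth (support_ideal \<I>) (support_ideal \<J> :: ('n, 'k::field) mpoly set) \<le> enat d \<or>
   (\<exists>\<phi>. inj_on \<phi> gens \<and> (\<forall>F\<in>gens. \<phi> F \<in> \<I> - \<J> \<and> card (\<phi> F) = Suc d \<and> F \<subseteq> \<phi> F))"
proof -
  define Y where "Y = {b \<in> \<I> - \<J>. card b = Suc d}"
  define v where "v F b = (\<Sum>j\<in>b. if b - {j} = F then ksign j b else 0 :: 'k)" for F b :: "'n set"
  \<comment> \<open>A combination of rows is the differential of \<open>c\<close> extended by 0
    outside \<open>gens\<close>.\<close>
  have v: "(\<Sum>F\<in>gens. c F * v F b) = (\<Sum>j\<in>b. ksign j b * (if b - {j} \<in> gens then c (b - {j}) else 0))"
    for c b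
  proof -
    have "(\<Sum>F\<in>gens. c F * v F b)
        = (\<Sum>F\<in>gens. \<Sum>j\<in>b. if b - {j} = F then ksign j b * c F else 0)"
      unfolding v_def sum_distrib_left
    proof (rule sum.cong[OF refl], rule sum.cong[OF refl])
      show "c F * (if b - {j} = F then ksign j b else 0)
          = (if b - {j} = F then ksign j b * c F else 0)" for F j
        by (cases "b - {j} = F")
             (simp_all only: simp_thms if_True if_False mult_zero_left mult_zero_right mult.commute)
    qed
    also have "\<dots> = (\<Sum>j\<in>b. \<Sum>F\<in>gens. if b - {j} = F then ksign j b * c F else 0)"
      by (rule sum.swap)
    also have "\<dots> = (\<Sum>j\<in>b. ksign j b * (if b - {j} \<in> gens then c (b - {j}) else 0))"
      by (rule sum.cong[OF refl])
         (simp only: sum.delta'[OF finite] if_distrib[of "(*) (ksign _ b)"] mult_zero_right)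
    finally show ?thesis .
  qed
  show ?thesis
  proof (cases "\<forall>c. (\<forall>b\<in>Y. (\<Sum>F\<in>gens. c F * v F b) = 0) \<longrightarrow> (\<forall>F\<in>gens. c F = 0)")
    case True
    have "\<exists>\<phi>. inj_on \<phi> gens \<and> (\<forall>F\<in>gens. \<phi> F \<in> Y \<and> v F (\<phi> F) \<noteq> 0)"
    proof (rule independent_rows_matching[OF finite finite])
      fix c assume "\<And>b. b \<in> Y \<Longrightarrow> (\<Sum>F\<in>gens. c F * v F b) = 0"
      then have "\<forall>b\<in>Y. (\<Sum>F\<in>gens. c F * v F b) = 0"
        by (rule ballI)
      with True[THEN spec, of c] show "\<forall>F\<in>gens. c F = 0"
        by (rule mp)
    qed
    then obtain \<phi> where \<phi>: "inj_on \<phi> gens" "\<forall>F\<in>gens. \<phi> F \<in> Y \<and> v F (\<phi> F) \<noteq> 0"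
      by blast
    have "F \<subseteq> \<phi> F" if "F \<in> gens" for F
    proof -
      have "v F (\<phi> F) \<noteq> 0"
        using \<phi>(2) that by blast
      have "\<exists>j. \<phi> F - {j} = F"
      proof (rule ccontr)
        assume "\<not> (\<exists>j. \<phi> F - {j} = F)"
        then have "v F (\<phi> F) = 0"
          by (simp add: v_def)
        with \<open>v F (\<phi> F) \<noteq> 0\<close> show False ..
      qed
      then show ?thesis
        by blast
    qed
    then have "\<forall>F\<in>gens. \<phi> F \<in> \<I> - \<J> \<and> card (\<phi> F) = Suc d \<and> F \<subseteq> \<phi> F"
      using \<phi>(2) unfolding Y_def by blast
    with \<phi>(1) show ?thesis
      by (intro disjI2 exI[of _ \<phi>] conjI)
  next
    case False
    then obtain c F\<^sub>0 where c: "\<And>b. b \<in> Y \<Longrightarrow> (\<Sum>F\<in>gens. c F * v F b) = 0"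
      and F\<^sub>0: "F\<^sub>0 \<in> gens" "c F\<^sub>0 \<noteq> 0"
      by (simp only: not_all not_imp) blast
    have "depth (support_ideal \<I>) (support_ideal \<J> :: ('n, 'k) mpoly set) \<le> enat d"
    proof (rule depth_le_kernel[of "\<lambda>F. if F \<in> gens then c F else 0" F\<^sub>0])
      show "(\<Sum>j\<in>b. ksign j b * (if b - {j} \<in> gens then c (b - {j}) else 0)) = 0"
        if "b \<in> \<I> - \<J>" "card b = Suc d" for b
        using c[of b] that by (simp add: v Y_def)
    qed (use F\<^sub>0 in \<open>auto split: if_splits\<close>)
    then show ?thesis ..
  qed
qed

end

section \<open>Lower bounds for the Stanley depth from matchings\<close>

lemma finite_sqfree_poset: "finite (sqfree_poset I J :: 'n::finite monomial set)"
proof (rule finite_imageD)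
  show "inj_on vars (sqfree_poset I J)"
    by (auto simp: inj_on_def sqfree_poset_def intro: squarefree_mon_eqI)
qed simp

text \<open>A single partition bounds the maximum. The poset is finite, so \<open>Max\<close> is
  taken over a finite set; it is nonempty, so \<open>Q\<close> is too and \<open>Min\<close> is
  meaningful.\<close>

lemma sdepth_ge:
  fixes I J :: "('n::finite, 'k::field) mpoly set"
  assumes Q: "interval_partition (sqfree_poset I J) Q"
    and "sqfree_poset I J \<noteq> {}" "\<And>u v. (u, v) \<in> Q \<Longrightarrow> m \<le> mdeg v"
  shows "m \<le> sdepth I J"
proof -
  let ?P = "sqfree_poset I J"
  have Q_sub: "Q \<subseteq> ?P \<times> ?P" if "interval_partition ?P Q" for Q
    using that by (simp only: interval_partition_def)
  have finP: "finite (?P \<times> ?P)"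
    by (intro finite_cartesian_product finite_sqfree_poset)
  have "{Q. interval_partition ?P Q} \<subseteq> Pow (?P \<times> ?P)"
    using Q_sub by blast
  then have "finite {Q. interval_partition ?P Q}"
    by (rule finite_subset) (simp only: finite_Pow_iff finP)
  then have le: "sdepth_partition Q \<le> sdepth I J"
    unfolding sdepth_def using Q by (intro Max_ge finite_imageI imageI CollectI)
  have "finite Q"
    using Q_sub[OF Q] finP by (rule finite_subset)
  moreover have "Q \<noteq> {}"
  proof
    assume "Q = {}"
    with Q have "?P = {}"
      by (simp add: interval_partition_def)
    with assms(2) show False ..
  qed
  ultimately have "m \<le> sdepth_partition Q"
    unfolding sdepth_partition_def using assms(3) by (intro Min.boundedI) auto
  with le show ?thesis
    by simp
qed

lemma interval_cover:
  assumes "\<And>w. w \<in> P \<Longrightarrow> squarefree_mon w" "u \<in> P" "v \<in> P" "mdvd u v" "mdeg v \<le> Suc (mdeg u)"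
  shows "interval P (u, v) = {u, v}"
proof
  have sq: "squarefree_mon u" "squarefree_mon v"
    using assms by blast+
  show "interval P (u, v) \<subseteq> {u, v}"
  proof
    fix w assume "w \<in> interval P (u, v)"
    then have w: "squarefree_mon w" "vars u \<subseteq> vars w" "vars w \<subseteq> vars v"
      using assms(1) sq by (auto simp: interval_def mdvd_squarefree_iff)
    have "vars w = vars u \<or> vars w = vars v"
    proof (rule ccontr)
      assume "\<not> ?thesis"
      then have "vars u \<subset> vars w" "vars w \<subset> vars v"
        using w by auto
      then have "card (vars u) < card (vars w)" "card (vars w) < card (vars v)"
        by (auto intro: psubset_card_mono)
      then show False
        using assms(5) sq by (simp add: mdeg_squarefree)
    qed
    then show "w \<in> {u, v}"
      using squarefree_mon_eqI w(1) sq by blast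
  qed
  show "{u, v} \<subseteq> interval P (u, v)"
    using assms(2-4) by (auto simp: interval_def mdvd_iff)
qed

text \<open>The partition consists of the intervals from \<open>u\<close> to \<open>\<phi> u\<close>
  for \<open>u\<close> in \<open>X\<close> and singletons for the unmatched rest. All upper
  endpoints lie outside \<open>X\<close>.\<close>

lemma sdepth_ge_matching:
  fixes I J :: "('n::finite, 'k::field) mpoly set"
  defines "P \<equiv> sqfree_poset I J"
  assumes "P \<noteq> {}" "X \<subseteq> P" "inj_on \<phi> X"
    and \<phi>: "\<And>u. u \<in> X \<Longrightarrow> \<phi> u \<in> P - X \<and> mdvd u (\<phi> u) \<and> mdeg (\<phi> u) = Suc (mdeg u)"
    and deg: "\<And>w. w \<in> P - X \<Longrightarrow> m \<le> mdeg w"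
  shows "m \<le> sdepth I J"
proof (rule sdepth_ge)
  define \<psi> where "\<psi> w = (if w \<in> X then \<phi> w else w)" for w
  \<comment> \<open>The lower endpoints: images under \<open>\<phi>\<close> are dropped because they
    are already upper endpoints.\<close>
  define Y where "Y = P - \<phi> ` X"
  define Q where "Q = (\<lambda>w. (w, \<psi> w)) ` Y"
  have sqfree: "squarefree_mon w" if "w \<in> P" for w
    using that by (simp add: P_def sqfree_poset_def)
  have \<psi>: "\<psi> w \<in> P - X \<and> mdvd w (\<psi> w) \<and> mdeg (\<psi> w) \<le> Suc (mdeg w)" if "w \<in> P" for w
    using \<phi>[of w] that by (auto simp: \<psi>_def mdvd_iff)
  have int: "interval P (w, \<psi> w) = {w, \<psi> w}" if "w \<in> Y" for w
    using interval_cover[OF sqfree, of P w "\<psi> w"] \<psi>[of w] that by (auto simp: Y_def)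
  have ne: "\<psi> w \<noteq> \<psi> w'" "\<psi> w \<noteq> w'" if "w \<in> Y" "w' \<in> Y" "w \<noteq> w'" for w w'
    using that inj_onD[OF assms(4), of w w'] by (auto simp: \<psi>_def Y_def)
  have "disjoint_family_on (interval P) Q"
    unfolding disjoint_family_on_def
  proof (intro ballI impI)
    fix p q assume "p \<in> Q" "q \<in> Q" "p \<noteq> q"
    then obtain w w' where w: "w \<in> Y" "w' \<in> Y" "w \<noteq> w'" "p = (w, \<psi> w)" "q = (w', \<psi> w')"
      unfolding Q_def by blast
    then have "interval P p = {w, \<psi> w}" "interval P q = {w', \<psi> w'}"
      by (simp_all add: int)
    then show "interval P p \<inter> interval P q = {}"
      using w(3) ne[OF w(1-3)] ne[OF w(2,1) w(3)[symmetric]] by simp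
  qed
  moreover have "(\<Union>p\<in>Q. interval P p) = P"
  proof -
    have "(\<Union>p\<in>Q. interval P p) = (\<Union>w\<in>Y. {w, \<psi> w})"
      using int by (simp add: Q_def)
    also have "\<dots> = P"
    proof
      show "(\<Union>w\<in>Y. {w, \<psi> w}) \<subseteq> P"
        using \<psi> by (auto simp: Y_def)
      show "P \<subseteq> (\<Union>w\<in>Y. {w, \<psi> w})"
      proof
        fix w assume "w \<in> P"
        show "w \<in> (\<Union>w\<in>Y. {w, \<psi> w})"
        proof (cases "w \<in> Y")
          case False
          then obtain u where u: "u \<in> X" "w = \<phi> u"
            using \<open>w \<in> P\<close> by (auto simp: Y_def)
          then have "u \<in> Y"
            using \<phi> assms(3) by (auto simp: Y_def)
          then show ?thesis
            using u by (auto simp: \<psi>_def)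
        qed auto
      qed
    qed
    finally show ?thesis .
  qed
  moreover have "Q \<subseteq> P \<times> P" "\<forall>(u, v)\<in>Q. mdvd u v"
    using \<psi> by (auto simp: Q_def Y_def)
  ultimately show "interval_partition (sqfree_poset I J) Q"
    unfolding interval_partition_def P_def by (intro conjI)
  show "m \<le> mdeg v" if "(u, v) \<in> Q" for u v
    using that \<psi> deg by (auto simp: Q_def Y_def)
qed (use assms(2) in \<open>simp add: P_def\<close>)

text \<open>For \<open>\<tau> = UNIV\<close> all exponents on \<open>S\<close> are 1, so this is the
  squarefree monomial with support \<open>S\<close>, the way back from sets to monomials.\<close>

lemma squarefree_mon_twist_mon: "squarefree_mon (twist_mon UNIV S :: 'n::finite monomial)"
  by (simp add: squarefree_mon_def lookup_twist_mon)

lemma mem_sqfree_poset_support_ideal: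
  "u \<in> sqfree_poset (support_ideal \<I>) (support_ideal \<J> :: ('n, 'k::field) mpoly set) \<longleftrightarrow>
     squarefree_mon u \<and> vars u \<in> \<I> - \<J>"
  by (simp add: sqfree_poset_def mon_in_support_ideal)

context initial_degree
begin

lemma sdepth_ge_matching_gens:
  assumes "inj_on \<phi> gens" "\<And>F. F \<in> gens \<Longrightarrow> \<phi> F \<in> \<I> - \<J> \<and> card (\<phi> F) = Suc d \<and> F \<subseteq> \<phi> F"
    and "gens \<noteq> {}"
  shows "Suc d \<le> sdepth (support_ideal \<I>) (support_ideal \<J> :: ('n, 'k::field) mpoly set)"
proof (rule sdepth_ge_matching)
  let ?P = "sqfree_poset (support_ideal \<I>) (support_ideal \<J> :: ('n, 'k) mpoly set)"
  define X where "X = {u \<in> ?P. vars u \<in> gens}"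
  define \<psi> :: "'n monomial \<Rightarrow> 'n monomial" where "\<psi> u = twist_mon UNIV (\<phi> (vars u))" for u
  note mem = mem_sqfree_poset_support_ideal[where ?'k = 'k]
  obtain F where "F \<in> gens"
    using assms(3) by blast
  then have "twist_mon UNIV F \<in> ?P"
    using gens_subset by (auto simp: mem squarefree_mon_twist_mon vars_twist_mon)
  then show "?P \<noteq> {}"
    by blast
  show "X \<subseteq> ?P"
    by (auto simp: X_def)
  show "inj_on \<psi> X"
  proof (rule inj_onI)
    fix u w assume uw: "u \<in> X" "w \<in> X" "\<psi> u = \<psi> w"
    then have "\<phi> (vars u) = \<phi> (vars w)"
      unfolding \<psi>_def by (metis vars_twist_mon)
    then have "vars u = vars w"
      using inj_onD[OF assms(1)] uw by (auto simp: X_def)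
    then show "u = w"
      using uw by (intro squarefree_mon_eqI) (auto simp: X_def mem)
  qed
  show "\<psi> u \<in> ?P - X \<and> mdvd u (\<psi> u) \<and> mdeg (\<psi> u) = Suc (mdeg u)" if "u \<in> X" for u
  proof -
    have u: "squarefree_mon u" "vars u \<in> gens"
      using that by (auto simp: X_def mem)
    have \<phi>: "\<phi> (vars u) \<in> \<I> - \<J>" "card (\<phi> (vars u)) = Suc d" "vars u \<subseteq> \<phi> (vars u)"
      using assms(2)[OF u(2)] by blast+
    have \<psi>: "squarefree_mon (\<psi> u)" "vars (\<psi> u) = \<phi> (vars u)"
      by (simp_all add: \<psi>_def squarefree_mon_twist_mon vars_twist_mon)
    have "mdeg u = d"
      using u by (simp add: mdeg_squarefree gens_def)
    moreover have "mdvd u (\<psi> u)"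
      using u(1) \<psi>(2) \<phi>(3) by (simp add: mdvd_squarefree_iff)
    moreover have "mdeg (\<psi> u) = Suc d"
      using \<psi> \<phi>(2) by (simp add: mdeg_squarefree)
    moreover have "\<psi> u \<in> ?P"
      using \<psi> \<phi>(1) by (simp add: mem)
    moreover have "\<psi> u \<notin> X"
      using \<psi>(2) \<phi>(2) by (simp add: X_def gens_def)
    ultimately show ?thesis
      by simp
  qed
  show "Suc d \<le> mdeg w" if "w \<in> ?P - X" for w
  proof -
    have "squarefree_mon w" "vars w \<in> \<I>" "vars w \<notin> gens"
      using that by (auto simp: X_def mem)
    then show ?thesis
      using card_I[of "vars w"] by (auto simp: mdeg_squarefree gens_def)
  qed
qed

lemma sdepth_ge_initial_degree:
  assumes "gens \<noteq> {}"
  shows "d \<le> sdepth (support_ideal \<I>) (support_ideal \<J> :: ('n, 'k::field) mpoly set)"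
proof (rule sdepth_ge_matching)
  let ?P = "sqfree_poset (support_ideal \<I>) (support_ideal \<J> :: ('n, 'k) mpoly set)"
  note mem = mem_sqfree_poset_support_ideal[where ?'k = 'k]
  obtain F where "F \<in> gens"
    using assms by blast
  then have "twist_mon UNIV F \<in> ?P"
    using gens_subset by (auto simp: mem squarefree_mon_twist_mon vars_twist_mon)
  then show "?P \<noteq> {}"
    by blast
  \<comment> \<open>The matched set is empty here, so the partition is the one into
    singletons.\<close>
  show "d \<le> mdeg w" if "w \<in> ?P - {}" for w
    using that card_I[of "vars w"] by (auto simp: mem mdeg_squarefree)
qed auto

end

context linked_generators
begin

theorem depth_le_sdepth:
  "depth (support_ideal \<I>) (support_ideal \<J> :: ('a, 'k::field) mpoly set)
     \<le> enat (sdepth (support_ideal \<I>) (support_ideal \<J> :: ('a, 'k) mpoly set))"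
  (is "?depth \<le> enat ?sdepth")
  using depth_le_or_matching[where ?'k = 'k]
proof
  assume "?depth \<le> enat d"
  also have "enat d \<le> enat ?sdepth"
    using sdepth_ge_initial_degree[OF gens_nonempty] by simp
  finally show ?thesis .
next
  assume "\<exists>\<phi>. inj_on \<phi> gens \<and> (\<forall>F\<in>gens. \<phi> F \<in> \<I> - \<J> \<and> card (\<phi> F) = Suc d \<and> F \<subseteq> \<phi> F)"
  then have "enat (Suc d) \<le> enat ?sdepth"
    using sdepth_ge_matching_gens[OF _ _ gens_nonempty] by auto
  with depth_le_Suc show ?thesis
    by (rule order.trans)
qed

end

section \<open>Translation of the hypotheses from monomials to supports\<close>

theorem corollary1:
  fixes I J :: "('n::finite, 'k::field) mpoly set"
    and f :: "nat \<Rightarrow> 'n monomial" and E W B C :: "'n monomial set" and d r :: nat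
  assumes "d \<ge> 1" and "r \<ge> 1"
    and "squarefree_monomial_ideal I" and "squarefree_monomial_ideal J" and "J \<subset> I"
    and "minimal_monomial_generators (f ` {1..r} \<union> E) I"
    and "inj_on f {1..r}"
    and "\<forall>i\<in>{1..r}. squarefree_mon (f i) \<and> mdeg (f i) = d"
    and "\<forall>u\<in>E. squarefree_mon u \<and> mdeg u \<ge> d + 1"
    and "J = {0} \<or> (\<exists>G. (\<forall>u\<in>G. mdeg u \<ge> d + 1) \<and> J = ideal_gen (mon ` G))"
    and "B = sqfree_mons_of_deg I J (d + 1)"
    and "C = sqfree_mons_of_deg I J (d + 2)"
    and "W = {mlcm (f i) (f j) | i j. 1 \<le> i \<and> i < j \<and> j \<le> r}"
    and "{u \<in> B. mon u \<in> (ideal_gen (mon ` f ` {1..r}) :: ('n, 'k) mpoly set)} \<subseteq> W"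
    and "C \<inter> W = {}"
  shows "depth I J \<le> enat (sdepth I J)"
proof -
  define \<I> where "\<I> = {S. \<exists>u\<in>f ` {1..r} \<union> E. vars u \<subseteq> S}"
  obtain G where G: "\<forall>u\<in>G. squarefree_mon u" "J = ideal_gen (mon ` G)"
    using assms(4) by (auto simp: squarefree_monomial_ideal_def)
  define \<J> where "\<J> = {S. \<exists>u\<in>G. vars u \<subseteq> S}"
  have "I = ideal_gen (mon ` (f ` {1..r} \<union> E))"
    using assms(6) by (simp add: minimal_monomial_generators_def)
  then have I: "I = support_ideal \<I>"
    unfolding \<I>_def using assms(8,9) by (subst ideal_gen_squarefree[symmetric]) auto
  have J: "J = support_ideal \<J>"
    unfolding \<J>_def G(2) by (rule ideal_gen_squarefree[OF G(1)])
  have f: "squarefree_mon (f i)" "card (vars (f i)) = d" if "i \<in> {1..r}" for i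
    using assms(8) that by (auto simp flip: mdeg_squarefree)
  have E: "d < card (vars u)" if "u \<in> E" for u
    using assms(9) that by (auto simp flip: mdeg_squarefree)
  interpret initial_degree \<I> \<J> d
  proof
    show "up_closed \<I>" "up_closed \<J>"
      by (auto simp: up_closed_def \<I>_def \<J>_def)
    show "d \<le> card S" if S: "S \<in> \<I>" for S
    proof -
      obtain u where "u \<in> f ` {1..r} \<union> E" "vars u \<subseteq> S"
        using S by (auto simp: \<I>_def)
      then have "d \<le> card (vars u)" "card (vars u) \<le> card S"
        using f(2) E by (auto simp: less_imp_le card_mono)
      then show ?thesis
        by simp
    qed
    show "d < card S" if S: "S \<in> \<J>" for S
    proof -
      obtain u where u: "u \<in> G" "vars u \<subseteq> S"
        using S by (auto simp: \<J>_def)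
      then have sq: "squarefree_mon u" and uJ: "mon u \<in> J"
        using G by (auto intro: ring_module.span_base)
      \<comment> \<open>This excludes \<open>J = {0}\<close>. The degree bound holds for
        \<open>G'\<close>, which may differ from the squarefree \<open>G\<close>; it passes to
        \<open>u\<close> by divisibility.\<close>
      have "mon u \<noteq> (0 :: ('n, 'k) mpoly)"
        by (metis lookup_single_eq lookup_zero mon_def zero_neq_one)
      then obtain G' where G': "\<forall>u\<in>G'. mdeg u \<ge> d + 1" "J = ideal_gen (mon ` G')"
        using assms(10) uJ by auto
      then obtain u' where "u' \<in> G'" "mdvd u' u"
        using uJ by (auto simp: mon_in_ideal_gen)
      then have "d < mdeg u"
        using G'(1) mdeg_mono[of u' u] by fastforce
      also have "mdeg u \<le> card S"
        using u(2) by (simp add: mdeg_squarefree[OF sq] card_mono)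
      finally show ?thesis .
    qed
  qed
  \<comment> \<open>Supports from \<open>E\<close> have more than \<open>d\<close> elements, so a
    \<open>d\<close>-set in \<open>\<I>\<close> can only contain, and then equals, the support of
    some \<open>f i\<close>.\<close>
  have gens: "gens = (\<lambda>i. vars (f i)) ` {1..r}"
  proof
    show "gens \<subseteq> (\<lambda>i. vars (f i)) ` {1..r}"
    proof
      fix F assume F: "F \<in> gens"
      then have "F \<in> \<I>"
        by (simp add: gens_def)
      then obtain u where u: "u \<in> f ` {1..r} \<union> E" "vars u \<subseteq> F"
        unfolding \<I>_def by blast
      then have "card (vars u) \<le> d"
        using F card_mono[of F "vars u"] by (simp add: gens_def)
      then obtain i where i: "i \<in> {1..r}" "u = f i"
        using u E by fastforce
      then have "vars (f i) = F"
        using u(2) F f(2) card_subset_eq[of F "vars (f i)"] by (simp add: gens_def)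
      then show "F \<in> (\<lambda>i. vars (f i)) ` {1..r}"
        using i by blast
    qed
    show "(\<lambda>i. vars (f i)) ` {1..r} \<subseteq> gens"
    proof clarify
      fix i assume i: "i \<in> {1..r}"
      then have "vars (f i) \<in> \<I>"
        unfolding \<I>_def by blast
      then show "vars (f i) \<in> gens"
        using f(2)[OF i] by (simp add: gens_def)
    qed
  qed
  interpret linked_generators \<I> \<J> d
  proof
    show "1 \<le> d" "gens \<noteq> {}"
      using assms(1,2) by (auto simp: gens)
    show "\<exists>F\<in>gens. \<exists>F'\<in>gens. F \<noteq> F' \<and> b = F \<union> F'"
      if b: "b \<in> \<I> - \<J>" "card b = Suc d" "F \<in> gens" "F \<subseteq> b" for b F
    proof -
      \<comment> \<open>The squarefree monomial with support \<open>b\<close>; it lies in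
        \<open>B\<close> and in the ideal of the \<open>f i\<close>, hence in
        \<open>W\<close>.\<close>
      let ?u = "twist_mon UNIV b"
      obtain i where i: "i \<in> {1..r}" "F = vars (f i)"
        using b(3) by (auto simp: gens)
      have "?u \<in> B"
        using b(1,2) unfolding assms(11) I J
        by (simp add: sqfree_mons_of_deg_def mem_sqfree_poset_support_ideal mdeg_squarefree
            squarefree_mon_twist_mon vars_twist_mon)
      moreover have "mdvd (f i) ?u"
        using f(1) i b(4) by (simp add: mdvd_squarefree_iff vars_twist_mon)
      then have "mon ?u \<in> (ideal_gen (mon ` f ` {1..r}) :: ('n, 'k) mpoly set)"
        using i(1) unfolding mon_in_ideal_gen by blast
      ultimately have "?u \<in> W"
        using assms(14) by blast
      then obtain j k where jk: "?u = mlcm (f j) (f k)" "1 \<le> j" "j < k" "k \<le> r"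
        unfolding assms(13) by blast
      then have range: "j \<in> {1..r}" "k \<in> {1..r}" "j \<noteq> k"
        by auto
      have "b = vars (f j) \<union> vars (f k)"
        using arg_cong[OF jk(1), of vars] by (simp add: vars_twist_mon vars_mlcm)
      moreover have "vars (f j) \<noteq> vars (f k)"
        using squarefree_mon_eqI[OF f(1) f(1)] inj_onD[OF assms(7)] range by blast
      ultimately show ?thesis
        using range(1,2) unfolding gens by blast
    qed
    have far: "vars (f i) \<union> vars (f j) \<notin> \<I> - \<J>"
      if ij: "1 \<le> i" "i < j" "j \<le> r" "card (vars (f i) \<union> vars (f j)) = Suc (Suc d)" for i j
    proof
      assume *: "vars (f i) \<union> vars (f j) \<in> \<I> - \<J>"
      have "squarefree_mon (mlcm (f i) (f j))"
        using ij by (intro squarefree_mon_mlcm f(1)) auto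
      then have "mlcm (f i) (f j) \<in> C"
        using * ij(4) unfolding assms(12) I J
        by (simp add: sqfree_mons_of_deg_def mem_sqfree_poset_support_ideal mdeg_squarefree vars_mlcm)
      moreover have "mlcm (f i) (f j) \<in> W"
        unfolding assms(13) using ij by blast
      ultimately show False
        using assms(15) by blast
    qed
    show "F \<union> F' \<notin> \<I> - \<J>"
      if FF': "F \<in> gens" "F' \<in> gens" "card (F \<union> F') = Suc (Suc d)" for F F'
    proof -
      obtain i j where ij: "i \<in> {1..r}" "j \<in> {1..r}" "F = vars (f i)" "F' = vars (f j)"
        using FF'(1,2) by (auto simp: gens)
      \<comment> \<open>Otherwise the union would have only \<open>d\<close> elements.\<close>
      have "i \<noteq> j"
        using FF'(3) f(2) ij by auto
      then consider "i < j" | "j < i"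
        by linarith
      then show ?thesis
      proof cases
        case 1
        then show ?thesis
          using far[of i j] ij FF'(3) by simp
      next
        case 2
        then show ?thesis
          using far[of j i] ij FF'(3) by (simp add: Un_commute)
      qed
    qed
  qed
  show ?thesis
    unfolding I J by (rule depth_le_sdepth)
qed

end
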